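(* Let $(\mathsf{W},\epsilon,\Delta)$ be the word cooperad over $\mathbb{K}$, let $\mathsf{X}\subseteq\mathsf{W}$ be the crossing species and $\mathsf{N}$ the non-crossing species, and let $\mathsf{W}\to\mathsf{N}\cong\mathsf{W}/\mathsf{X}$ be the quotient map (which is the identity on pangrammatic reduced non-crossing words and sends pangrammatic reduced crossing words to $0$). Then the quotient map $\mathsf{W}\to\mathsf{N}$ makes $\mathsf{N}$ a quotient cooperad of the word cooperad; that is, $\epsilon$ and $\Delta$ descend along the quotient map to maps $\mathsf{N}\to\mathsf{I}$ and $\mathsf{N}\to\mathsf{N}\,\bar{\circ}\,\mathsf{N}$ which make $\mathsf{N}$ a cooperad.
   Context: $\mathbb{K}$ is a field of characteristic zero. **Words.** A word $w$ is a nonempty finite sequence of elements (letters) of a set $S$ (the alphabet). It is pangrammatic if it contains every letter of $S$. It is reduced if it has no subword (of consecutive letters) of the form $aa$ and either has length one or has different first and last letters. The reduction $\overline{w}$ of $w$ is the unique minimal length word obtained from $w$ by repeatedly applying the moves $\ldots aa\ldots\mapsto\ldots a\ldots$ and $a\ldots a\mapsto a\ldots$, where in the second move $a$ is both the first and the last letter of the entire word (of length at least two) and the last letter is deleted. A word is non-crossing if it never contains a pattern $\ldots a\ldots b\ldots a\ldots b\ldots$ for distinct letters $a,b$; otherwise it is crossing. A map of sets $f:S\to T$ induces a map, also denoted $f$, from words on $S$ to words on $T$, letter by letter. If $w$ is a word on $T$ and $S\subseteq T$ contains at least one letter of $w$, then $w|S$ is the word obtained from $w$ by deleting all letters not in $S$.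 **Species and cooperads.** A (linear) species is a functor from finite sets and bijections to $\mathbb{K}$-vector spaces; it is reduced if its value on $\emptyset$ is $0$. The unit species $\mathsf{I}$ has $\mathsf{I}(S)=\mathbb{K}$ if $|S|=1$ and $0$ otherwise. The invariant plethysm of species $\mathsf{F},\mathsf{G}$ is $$(\mathsf{F}\,\bar{\circ}\,\mathsf{G})(S)=\lim_{f:S\to T}\Big(\mathsf{F}(T)\otimes\bigotimes_{t\in T}\mathsf{G}(f^{-1}(t))\Big),$$ the limit being over the category whose objects are maps $f$ from $S$ to finite sets $T$ and whose morphisms are isomorphisms under $S$. Reduced species with $\bar{\circ}$ and $\mathsf{I}$ form a monoidal category, and a cooperad is a comonoid $(\mathsf{C},\epsilon,\Delta)$ in it. The map $\Delta$ is specified by components $\Delta_f:\mathsf{C}(S)\to\mathsf{C}(T)\otimes\bigotimes_{t\in T}\mathsf{C}(f^{-1}(t))$ for surjections $f:S\twoheadrightarrow T$, compatible with bijections of $S$ and with bijections of $T$ under $S$. **The word cooperad.** $\mathsf{W}(S)$ is the $\mathbb{K}$-span of the pangrammatic reduced words on $S$, with bijections acting by relabeling; the counit $\epsilon$ takes the unique word on a singleton $S$ to $1\in\mathsf{I}(S)$; and $$\Delta_f(w)=\overline{f(w)}\otimes\bigotimes_{t\in T}\overline{w|f^{-1}(t)}$$ for each surjection $f:S\twoheadrightarrow T$. The triple $(\mathsf{W},\epsilon,\Delta)$ is a cooperad, called the word cooperad. **Crossing and non-crossing species.** $\mathsf{N}(S)$ (respectively $\mathsf{X}(S)$) is the $\mathbb{K}$-span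 of the pangrammatic reduced non-crossing (respectively crossing) words on $S$. *)

theory Defs
  imports
    "HOL-Library.Function_Algebras"
    "HOL-Library.FuncSet"
    "HOL-Library.Sublist"
    "HOL-Library.Infinite_Typeclass"
begin

section \<open>Vector spaces and tensor products\<close>

text \<open>
  A vector space over a field \<open>'k\<close> is presented as a linear subspace of a function space
  \<open>'b \<Rightarrow> 'k\<close> with pointwise operations; every vector space is isomorphic to one of this form
  (coordinates with respect to a basis).
\<close>

definition fscale :: "'k::field \<Rightarrow> ('b \<Rightarrow> 'k) \<Rightarrow> 'b \<Rightarrow> 'k" where
  "fscale c x = (\<lambda>b. c * x b)"

global_interpretation fun_space: vector_space fscale
  by unfold_locales (auto simp: fscale_def algebra_simps fun_eq_iff)

definition linear_on :: "('b \<Rightarrow> 'k::field) set \<Rightarrow> (('b \<Rightarrow> 'k) \<Rightarrow> ('c \<Rightarrow> 'k)) \<Rightarrow> bool" where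
  "linear_on V L \<longleftrightarrow>
     (\<forall>x\<in>V. \<forall>y\<in>V. L (x + y) = L x + L y) \<and> (\<forall>c. \<forall>x\<in>V. L (fscale c x) = fscale c (L x))"

definition delta :: "'b \<Rightarrow> 'b \<Rightarrow> 'k::field" where
  "delta b = (\<lambda>b'. if b' = b then 1 else 0)"

text \<open>
  The linear extension of \<open>m\<close> from basis vectors \<open>delta b\<close> to their span, which consists of
  functions of finite support.
\<close>

definition lin_ext :: "('b \<Rightarrow> 'c \<Rightarrow> 'k::field) \<Rightarrow> ('b \<Rightarrow> 'k) \<Rightarrow> ('c \<Rightarrow> 'k)" where
  "lin_ext m x = (\<Sum>b | x b \<noteq> 0. fscale (x b) (m b))"

text \<open>
  The tensor product of \<open>V\<close> with the unordered tensor product of the \<open>W t\<close>, \<open>t \<in> T\<close>.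
  For subspaces of function spaces over a field, the canonical linear map from the tensor product
  to functions on the product of the index sets, sending a pure tensor to the product of its
  factors, is injective; the tensor product is taken to be its image, the span of the pure
  tensors. Tensors do not depend on the coordinates \<open>c t\<close> with \<open>t \<notin> T\<close>.
\<close>

definition pure :: "'t set \<Rightarrow> ('b \<Rightarrow> 'k) \<Rightarrow> ('t \<Rightarrow> 'c \<Rightarrow> 'k) \<Rightarrow> 'b \<times> ('t \<Rightarrow> 'c) \<Rightarrow> 'k::field" where
  "pure T x y = (\<lambda>(b, c). x b * (\<Prod>t\<in>T. y t (c t)))"

definition tensor ::
  "('b \<Rightarrow> 'k) set \<Rightarrow> 't set \<Rightarrow> ('t \<Rightarrow> ('c \<Rightarrow> 'k) set) \<Rightarrow> ('b \<times> ('t \<Rightarrow> 'c) \<Rightarrow> 'k::field) set" where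
  "tensor V T W = fun_space.span {pure T x y | x y. x \<in> V \<and> (\<forall>t\<in>T. y t \<in> W t)}"

text \<open>
  The linear map on the tensor product induced by a multilinear \<open>m\<close>, i.e. the unique linear map
  sending the pure tensor of \<open>x\<close> and \<open>y\<close> to \<open>m x y\<close>.
\<close>

definition tensor_lift ::
  "('b \<Rightarrow> 'k) set \<Rightarrow> 't set \<Rightarrow> ('t \<Rightarrow> ('c \<Rightarrow> 'k) set) \<Rightarrow>
   (('b \<Rightarrow> 'k) \<Rightarrow> ('t \<Rightarrow> 'c \<Rightarrow> 'k) \<Rightarrow> ('d \<Rightarrow> 'k)) \<Rightarrow>
   ('b \<times> ('t \<Rightarrow> 'c) \<Rightarrow> 'k::field) \<Rightarrow> ('d \<Rightarrow> 'k)" where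
  "tensor_lift V T W m \<tau> =
     (THE z. \<exists>L. linear_on (tensor V T W) L \<and>
                 (\<forall>x y. x \<in> V \<and> (\<forall>t\<in>T. y t \<in> W t) \<longrightarrow> L (pure T x y) = m x y) \<and>
                 z = L \<tau>)"

definition tensor_map ::
  "('b \<Rightarrow> 'k) set \<Rightarrow> 't set \<Rightarrow> ('t \<Rightarrow> ('c \<Rightarrow> 'k) set) \<Rightarrow>
   (('b \<Rightarrow> 'k) \<Rightarrow> ('d \<Rightarrow> 'k)) \<Rightarrow> ('t \<Rightarrow> ('c \<Rightarrow> 'k) \<Rightarrow> ('e \<Rightarrow> 'k)) \<Rightarrow>
   ('b \<times> ('t \<Rightarrow> 'c) \<Rightarrow> 'k::field) \<Rightarrow> ('d \<times> ('t \<Rightarrow> 'e) \<Rightarrow> 'k)" where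
  "tensor_map V T W A B = tensor_lift V T W (\<lambda>x y. pure T (A x) (\<lambda>t. B t (y t)))"


section \<open>Species\<close>

text \<open>
  The category of finite sets is represented by the finite subsets of a type \<open>'a\<close>, to which it is
  equivalent as soon as \<open>'a\<close> is infinite. For \<open>\<sigma>\<close> injective on \<open>S\<close>, \<open>act F \<sigma> S\<close> is the value
  of \<open>F\<close> on the bijection from \<open>S\<close> to \<open>\<sigma> ` S\<close> given by \<open>\<sigma>\<close>.
\<close>

record ('a, 'b, 'k) species =
  val :: "'a set \<Rightarrow> ('b \<Rightarrow> 'k) set"
  act :: "('a \<Rightarrow> 'a) \<Rightarrow> 'a set \<Rightarrow> ('b \<Rightarrow> 'k) \<Rightarrow> ('b \<Rightarrow> 'k)"

definition is_species :: "('a, 'b, 'k::field) species \<Rightarrow> bool" where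
  "is_species F \<longleftrightarrow>
     (\<forall>S. finite S \<longrightarrow> fun_space.subspace (val F S)) \<and>
     (\<forall>S \<sigma>. finite S \<and> inj_on \<sigma> S \<longrightarrow>
        linear_on (val F S) (act F \<sigma> S) \<and> act F \<sigma> S \<in> val F S \<rightarrow> val F (\<sigma> ` S)) \<and>
     (\<forall>S \<sigma> \<sigma>'. finite S \<and> inj_on \<sigma> S \<and> (\<forall>s\<in>S. \<sigma> s = \<sigma>' s) \<longrightarrow>
        (\<forall>x\<in>val F S. act F \<sigma> S x = act F \<sigma>' S x)) \<and>
     (\<forall>S. finite S \<longrightarrow> (\<forall>x\<in>val F S. act F id S x = x)) \<and>
     (\<forall>S \<sigma> \<rho>. finite S \<and> inj_on \<sigma> S \<and> inj_on \<rho> (\<sigma> ` S) \<longrightarrow>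
        (\<forall>x\<in>val F S. act F (\<rho> \<circ> \<sigma>) S x = act F \<rho> (\<sigma> ` S) (act F \<sigma> S x)))"

definition reduced_species :: "('a, 'b, 'k::field) species \<Rightarrow> bool" where
  "reduced_species F \<longleftrightarrow> is_species F \<and> val F {} = {0}"

definition species_hom ::
  "('a, 'b, 'k::field) species \<Rightarrow> ('a, 'c, 'k) species \<Rightarrow>
   ('a set \<Rightarrow> ('b \<Rightarrow> 'k) \<Rightarrow> ('c \<Rightarrow> 'k)) \<Rightarrow> bool" where
  "species_hom F G \<phi> \<longleftrightarrow>
     (\<forall>S. finite S \<longrightarrow> linear_on (val F S) (\<phi> S) \<and> \<phi> S \<in> val F S \<rightarrow> val G S) \<and>
     (\<forall>S \<sigma>. finite S \<and> inj_on \<sigma> S \<longrightarrow>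
        (\<forall>x\<in>val F S. \<phi> (\<sigma> ` S) (act F \<sigma> S x) = act G \<sigma> S (\<phi> S x)))"

definition id_hom :: "'a set \<Rightarrow> ('b \<Rightarrow> 'k) \<Rightarrow> ('b \<Rightarrow> 'k)" where
  "id_hom S x = x"

definition unit_species :: "('a, unit, 'k::field) species" where
  "unit_species = \<lparr>val = (\<lambda>S. if card S = 1 then UNIV else {0}), act = (\<lambda>\<sigma> S x. x)\<rparr>"


section \<open>Invariant plethysm\<close>

definition fiber :: "'a set \<Rightarrow> ('a \<Rightarrow> 'a) \<Rightarrow> 'a \<Rightarrow> 'a set" where
  "fiber S f t = {s \<in> S. f s = t}"

text \<open>
  An element \<open>\<theta>\<close> of the limit is a family of tensors \<open>component \<theta> f T\<close>, one for each map
  \<open>f\<close> from \<open>S\<close> to a finite set \<open>T\<close>. It is stored as a single function, so that the plethysm is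
  again a species in the above sense; by convention it vanishes at all other \<open>(f, T)\<close>. In order
  that a map be the same thing as its representing function, \<open>f\<close> is required to be extensional.
\<close>

definition maps_to :: "'a set \<Rightarrow> ('a \<Rightarrow> 'a) \<Rightarrow> 'a set \<Rightarrow> bool" where
  "maps_to S f T \<longleftrightarrow> finite T \<and> f \<in> S \<rightarrow>\<^sub>E T"

definition component ::
  "(('a \<Rightarrow> 'a) \<times> 'a set \<times> 'z \<Rightarrow> 'k) \<Rightarrow> ('a \<Rightarrow> 'a) \<Rightarrow> 'a set \<Rightarrow> 'z \<Rightarrow> 'k" where
  "component \<theta> f T = (\<lambda>z. \<theta> (f, T, z))"

text \<open>
  The morphisms of the indexing category are the isomorphisms \<open>\<sigma>\<close> from \<open>T\<close> to \<open>\<sigma> ` T\<close>, from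
  \<open>f\<close> to \<open>\<sigma> \<circ> f\<close>. Such a morphism acts on the first tensor factor through \<open>F\<close> and moves the
  factor at \<open>t\<close> to \<open>\<sigma> t\<close>, the two fibers being equal.
\<close>

definition pleth ::
  "('a, 'b, 'k::field) species \<Rightarrow> ('a, 'c, 'k) species \<Rightarrow>
   ('a, ('a \<Rightarrow> 'a) \<times> 'a set \<times> 'b \<times> ('a \<Rightarrow> 'c), 'k) species" where
  "pleth F G =
     \<lparr>val = (\<lambda>S. {\<theta>.
        (\<forall>f T. if maps_to S f T
               then component \<theta> f T \<in> tensor (val F T) T (\<lambda>t. val G (fiber S f t))
               else component \<theta> f T = 0) \<and>
        (\<forall>f T \<sigma>. maps_to S f T \<and> inj_on \<sigma> T \<longrightarrow>
           component \<theta> (compose S \<sigma> f) (\<sigma> ` T) =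
             tensor_lift (val F T) T (\<lambda>t. val G (fiber S f t))
               (\<lambda>x y. pure (\<sigma> ` T) (act F \<sigma> T x) (\<lambda>t'. y (inv_into T \<sigma> t')))
               (component \<theta> f T))}),
      act = (\<lambda>\<rho> S \<theta> (f, T, z).
        if maps_to (\<rho> ` S) f T
        then (let g = compose S f \<rho> in
              tensor_map (val F T) T (\<lambda>t. val G (fiber S g t))
                (\<lambda>x. x) (\<lambda>t. act G \<rho> (fiber S g t)) (component \<theta> g T) z)
        else 0)\<rparr>"

definition pleth_map ::
  "('a, 'b, 'k::field) species \<Rightarrow> ('a, 'c, 'k) species \<Rightarrow>
   ('a set \<Rightarrow> ('b \<Rightarrow> 'k) \<Rightarrow> ('d \<Rightarrow> 'k)) \<Rightarrow> ('a set \<Rightarrow> ('c \<Rightarrow> 'k) \<Rightarrow> ('e \<Rightarrow> 'k)) \<Rightarrow>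
   'a set \<Rightarrow> (('a \<Rightarrow> 'a) \<times> 'a set \<times> 'b \<times> ('a \<Rightarrow> 'c) \<Rightarrow> 'k) \<Rightarrow>
   (('a \<Rightarrow> 'a) \<times> 'a set \<times> 'd \<times> ('a \<Rightarrow> 'e) \<Rightarrow> 'k)" where
  "pleth_map F G \<phi> \<psi> S \<theta> = (\<lambda>(f, T, z).
     if maps_to S f T
     then tensor_map (val F T) T (\<lambda>t. val G (fiber S f t))
            (\<phi> T) (\<lambda>t. \<psi> (fiber S f t)) (component \<theta> f T) z
     else 0)"

text \<open>
  The associativity isomorphism from \<open>pleth F (pleth G H)\<close> to \<open>pleth (pleth F G) H\<close>. For composable
  maps \<open>f\<close> from \<open>S\<close> to \<open>T\<close> and \<open>g\<close> from \<open>T\<close> to \<open>U\<close>, both sides have a component in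
  the tensor product of \<open>F U\<close>, the \<open>G (fiber T g u)\<close> and the \<open>H (fiber S f t)\<close>; on the
  left it is the component at \<open>g \<circ> f\<close> and at the restrictions of \<open>f\<close> from \<open>fiber S (g \<circ> f) u\<close>
  to \<open>fiber T g u\<close>, on the right the one at \<open>f\<close> and \<open>g\<close>. The isomorphism identifies these,
  up to the evident bijection of coordinates.
\<close>

definition pleth_assoc ::
  "'a set \<Rightarrow>
   (('a \<Rightarrow> 'a) \<times> 'a set \<times> 'b \<times> ('a \<Rightarrow> ('a \<Rightarrow> 'a) \<times> 'a set \<times> 'c \<times> ('a \<Rightarrow> 'd)) \<Rightarrow> 'k::field) \<Rightarrow>
   (('a \<Rightarrow> 'a) \<times> 'a set \<times> (('a \<Rightarrow> 'a) \<times> 'a set \<times> 'b \<times> ('a \<Rightarrow> 'c)) \<times> ('a \<Rightarrow> 'd) \<Rightarrow> 'k)" where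
  "pleth_assoc S \<Psi> = (\<lambda>(f, T, (g, U, a, b), c).
     if maps_to S f T \<and> maps_to T g U
     then \<Psi> (compose S g f, U, a,
             \<lambda>u. (restrict f (fiber S (compose S g f) u), fiber T g u, b u, c))
     else 0)"

text \<open>
  The unit isomorphisms from \<open>F\<close> to \<open>pleth unit_species F\<close> and to \<open>pleth F unit_species\<close>
  for reduced \<open>F\<close>. The tensor products occurring in these plethysms vanish unless \<open>T\<close> is a
  singleton, respectively unless \<open>f\<close> is a bijection (for injective \<open>f\<close> that is not surjective,
  because an empty fiber contributes \<open>0\<close>).
\<close>

definition left_unit ::
  "'a set \<Rightarrow> ('b \<Rightarrow> 'k::field) \<Rightarrow> (('a \<Rightarrow> 'a) \<times> 'a set \<times> unit \<times> ('a \<Rightarrow> 'b) \<Rightarrow> 'k)" where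
  "left_unit S x = (\<lambda>(f, T, z).
     if maps_to S f T \<and> card T = 1 then pure T 1 (\<lambda>t. x) z else 0)"

definition right_unit ::
  "('a, 'b, 'k::field) species \<Rightarrow> 'a set \<Rightarrow> ('b \<Rightarrow> 'k) \<Rightarrow>
   (('a \<Rightarrow> 'a) \<times> 'a set \<times> 'b \<times> ('a \<Rightarrow> unit) \<Rightarrow> 'k)" where
  "right_unit F S x = (\<lambda>(f, T, z).
     if maps_to S f T \<and> bij_betw f S T then pure T (act F f S x) (\<lambda>t. 1) z else 0)"


section \<open>Cooperads\<close>

definition cooperad ::
  "('a, 'b, 'k::field) species \<Rightarrow>
   ('a set \<Rightarrow> ('b \<Rightarrow> 'k) \<Rightarrow> (unit \<Rightarrow> 'k)) \<Rightarrow>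
   ('a set \<Rightarrow> ('b \<Rightarrow> 'k) \<Rightarrow> (('a \<Rightarrow> 'a) \<times> 'a set \<times> 'b \<times> ('a \<Rightarrow> 'b) \<Rightarrow> 'k)) \<Rightarrow> bool" where
  "cooperad C \<epsilon> \<Delta> \<longleftrightarrow>
     reduced_species C \<and>
     species_hom C unit_species \<epsilon> \<and>
     species_hom C (pleth C C) \<Delta> \<and>
     (\<forall>S. finite S \<longrightarrow> (\<forall>x\<in>val C S.
        pleth_assoc S (pleth_map C C id_hom \<Delta> S (\<Delta> S x)) = pleth_map C C \<Delta> id_hom S (\<Delta> S x) \<and>
        pleth_map C C \<epsilon> id_hom S (\<Delta> S x) = left_unit S x \<and>
        pleth_map C C id_hom \<epsilon> S (\<Delta> S x) = right_unit C S x))"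

definition is_quotient_map ::
  "('a, 'b, 'k::field) species \<Rightarrow> ('a, 'b, 'k) species \<Rightarrow> ('a, 'c, 'k) species \<Rightarrow>
   ('a set \<Rightarrow> ('b \<Rightarrow> 'k) \<Rightarrow> ('c \<Rightarrow> 'k)) \<Rightarrow> bool" where
  "is_quotient_map F X Q q \<longleftrightarrow>
     is_species F \<and> is_species X \<and> is_species Q \<and> species_hom X F id_hom \<and> species_hom F Q q \<and>
     (\<forall>S. finite S \<longrightarrow> q S ` val F S = val Q S \<and> {x \<in> val F S. q S x = 0} = val X S)"

text \<open>
  The structure maps of a cooperad structure on \<open>F\<close> descend along \<open>q\<close> and make \<open>Q\<close> a cooperad. For
  surjective \<open>q\<close> the descended maps are unique on \<open>Q\<close>.
\<close>

definition quotient_cooperad ::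
  "('a, 'b, 'k::field) species \<Rightarrow>
   ('a set \<Rightarrow> ('b \<Rightarrow> 'k) \<Rightarrow> (unit \<Rightarrow> 'k)) \<Rightarrow>
   ('a set \<Rightarrow> ('b \<Rightarrow> 'k) \<Rightarrow> (('a \<Rightarrow> 'a) \<times> 'a set \<times> 'b \<times> ('a \<Rightarrow> 'b) \<Rightarrow> 'k)) \<Rightarrow>
   ('a, 'c, 'k) species \<Rightarrow>
   ('a set \<Rightarrow> ('b \<Rightarrow> 'k) \<Rightarrow> ('c \<Rightarrow> 'k)) \<Rightarrow> bool" where
  "quotient_cooperad F \<epsilon> \<Delta> Q q \<longleftrightarrow>
     (\<exists>\<epsilon>' \<Delta>'.
        (\<forall>S. finite S \<longrightarrow> (\<forall>x\<in>val F S.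
           \<epsilon>' S (q S x) = \<epsilon> S x \<and>
           \<Delta>' S (q S x) = pleth_map F F q q S (\<Delta> S x))) \<and>
        cooperad Q \<epsilon>' \<Delta>')"


section \<open>Words\<close>

inductive word_move :: "'a list \<Rightarrow> 'a list \<Rightarrow> bool" where
  contract: "word_move (xs @ [a, a] @ ys) (xs @ [a] @ ys)"
| cyclic: "word_move (a # xs @ [a]) (a # xs)"

definition reduction :: "'a list \<Rightarrow> 'a list" where
  "reduction w = (THE v. is_arg_min length (word_move\<^sup>*\<^sup>* w) v)"

definition reduced_word :: "'a list \<Rightarrow> bool" where
  "reduced_word w \<longleftrightarrow>
     w \<noteq> [] \<and> (\<nexists>xs a ys. w = xs @ [a, a] @ ys) \<and> (length w = 1 \<or> hd w \<noteq> last w)"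

text \<open>The pangrammatic reduced words on \<open>S\<close>.\<close>

definition words :: "'a set \<Rightarrow> 'a list set" where
  "words S = {w. reduced_word w \<and> set w = S}"

definition crossing :: "'a list \<Rightarrow> bool" where
  "crossing w \<longleftrightarrow> (\<exists>a b. a \<noteq> b \<and> subseq [a, b, a, b] w)"

definition word_restrict :: "'a list \<Rightarrow> 'a set \<Rightarrow> 'a list" where
  "word_restrict w A = filter (\<lambda>a. a \<in> A) w"

definition relabel :: "('a \<Rightarrow> 'a) \<Rightarrow> 'a set \<Rightarrow> ('a list \<Rightarrow> 'k::field) \<Rightarrow> ('a list \<Rightarrow> 'k)" where
  "relabel \<sigma> S = lin_ext (\<lambda>w. delta (map \<sigma> w))"

definition word_species :: "('a, 'a list, 'k::field) species" where
  "word_species = \<lparr>val = (\<lambda>S. fun_space.span (delta ` words S)), act = relabel\<rparr>"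

definition crossing_species :: "('a, 'a list, 'k::field) species" where
  "crossing_species =
     \<lparr>val = (\<lambda>S. fun_space.span (delta ` {w \<in> words S. crossing w})), act = relabel\<rparr>"

definition noncrossing_species :: "('a, 'a list, 'k::field) species" where
  "noncrossing_species =
     \<lparr>val = (\<lambda>S. fun_space.span (delta ` {w \<in> words S. \<not> crossing w})), act = relabel\<rparr>"

definition word_counit :: "'a set \<Rightarrow> ('a list \<Rightarrow> 'k::field) \<Rightarrow> (unit \<Rightarrow> 'k)" where
  "word_counit S = lin_ext (\<lambda>w. if card S = 1 then 1 else 0)"

text \<open>
  The components at non-surjective maps are \<open>0\<close>, as they lie in a tensor product with the factor
  \<open>val word_species {} = {0}\<close>.
\<close>

definition word_comult ::
  "'a set \<Rightarrow> ('a list \<Rightarrow> 'k::field) \<Rightarrow>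
   (('a \<Rightarrow> 'a) \<times> 'a set \<times> 'a list \<times> ('a \<Rightarrow> 'a list) \<Rightarrow> 'k)" where
  "word_comult S = lin_ext (\<lambda>w (f, T, z).
     if maps_to S f T \<and> f ` S = T
     then pure T (delta (reduction (map f w)))
            (\<lambda>t. delta (reduction (word_restrict w (fiber S f t)))) z
     else 0)"

definition noncrossing_quotient ::
  "'a set \<Rightarrow> ('a list \<Rightarrow> 'k::field) \<Rightarrow> ('a list \<Rightarrow> 'k)" where
  "noncrossing_quotient S = lin_ext (\<lambda>w. if crossing w then 0 else delta w)"

end

(*
  The cooperad axioms for N are statements about words, checked on basis vectors. They rest on two
  facts about the reduction of words: it commutes, up to a further reduction, with relabeling and
  with restriction of letters, and it preserves crossing. If w is crossing in the letters a and b,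
  then f w is crossing when f a and f b differ, and otherwise the restriction of w to the fiber of
  f a is crossing. So the crossing words span a coideal: any decomposition of a crossing word has a
  crossing factor, and the comultiplication descends to the non-crossing words.
*)
theory Submission
  imports Defs
begin

section \<open>Reduction and crossings\<close>

text \<open>Both \<open>reduction\<close> and \<open>tensor_lift\<close> are definite descriptions,
  and this shapes the first half. For \<open>reduction\<close>, uniqueness comes from an explicit
  normal form that is constant along moves. A single deletion of the last letter is enough in it:
  once adjacent repetitions are gone, the letter before a deleted last letter differs from that
  letter, hence from the first letter. For \<open>tensor_lift\<close>, uniqueness is immediate
  because pure tensors span, but existence requires an actual linear map, which is built from the
  coordinates of finitely supported vectors. The axioms for N are checked directly instead of being
  inherited from W: each basis word is replaced by its image in N, which is 0 for a crossing word.
  All composites of the comultiplication occurring in the axioms are brought to the single form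
  \<open>lin_ext (cut S A B)\<close>, so that each axiom becomes an assertion about one word at a
  time.\<close>

definition normal_form :: "'a list \<Rightarrow> 'a list" where
  "normal_form w = (let v = remdups_adj w in if length v > 1 \<and> hd v = last v then butlast v else v)"

lemma reduced_word_iff:
  "reduced_word w \<longleftrightarrow> w \<noteq> [] \<and> distinct_adj w \<and> (length w = 1 \<or> hd w \<noteq> last w)"
proof -
  have "(\<exists>xs a ys. w = xs @ [a, a] @ ys) \<longleftrightarrow> \<not> distinct_adj w"
  proof
    assume "\<not> distinct_adj w"
    then show "\<exists>xs a ys. w = xs @ [a, a] @ ys"
    proof (induction w)
      case (Cons a w)
      show ?case
      proof (cases "distinct_adj w")
        case True
        with Cons.prems have "w \<noteq> [] \<and> hd w = a"
          by (auto simp: distinct_adj_Cons)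
        then have "a # w = [] @ [a, a] @ tl w"
          by (cases w) auto
        then show ?thesis by blast
      next
        case False
        then obtain xs b ys where "w = xs @ [b, b] @ ys"
          using Cons.IH by blast
        then have "a # w = (a # xs) @ [b, b] @ ys" by simp
        then show ?thesis by blast
      qed
    qed simp
  qed auto
  then show ?thesis
    by (auto simp: reduced_word_def)
qed

lemma normal_form_reduced: "reduced_word w \<Longrightarrow> normal_form w = w"
  by (auto simp: reduced_word_iff normal_form_def Let_def distinct_adj_altdef)

lemma length_normal_form_le: "length (normal_form w) \<le> length w"
  using remdups_adj_length[of w] by (auto simp: normal_form_def Let_def simp del: remdups_adj_length)

text \<open>A contraction does not affect \<open>remdups_adj\<close>. In the cyclic move, the extra
  last letter either merges into an equal letter before it or survives as the one letter that
  \<open>butlast\<close> removes.\<close>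

lemma normal_form_word_move:
  assumes "word_move w v"
  shows "normal_form w = normal_form v"
  using assms
proof cases
  case (contract xs a ys)
  then show ?thesis
    using remdups_adj_append[of xs a "a # ys"] remdups_adj_append[of xs a ys]
    by (simp add: normal_form_def)
next
  case (cyclic a xs)
  let ?v = "remdups_adj (a # xs)"
  have ne: "?v \<noteq> []" and hd: "hd ?v = a" and last: "last ?v = last (a # xs)"
    by auto
  have snoc: "remdups_adj (ys @ [a]) = (if last ys = a then remdups_adj ys else remdups_adj ys @ [a])"
    if "ys \<noteq> []" for ys
    using that by (cases ys rule: rev_cases) (auto simp: remdups_adj_append_two)
  have split: "remdups_adj (a # xs @ [a]) = (if last (a # xs) = a then ?v else ?v @ [a])"
    using snoc[of "a # xs"] by simp
  show ?thesis
  proof (cases "last (a # xs) = a")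
    case True
    then show ?thesis using split cyclic by (simp add: normal_form_def del: remdups_adj.simps)
  next
    case False
    then show ?thesis using split cyclic ne hd last
      by (auto simp add: normal_form_def Let_def simp del: remdups_adj.simps)
  qed
qed

lemma word_move_if_not_reduced:
  assumes "w \<noteq> []" "\<not> reduced_word w"
  obtains v where "word_move w v" "length v < length w"
proof -
  consider xs a ys where "w = xs @ [a, a] @ ys" | "length w \<noteq> 1" "hd w = last w"
    using assms by (auto simp: reduced_word_def)
  then show thesis
  proof cases
    case 1
    then show thesis
      using that[OF word_move.contract[of xs a ys, folded 1]] by simp
  next
    case 2
    then obtain a xs where "w = a # xs @ [a]"
      using assms(1) by (cases w; cases "tl w" rule: rev_cases) auto
    then show thesis
      using that word_move.cyclic[of a xs] by simp
  qed
qed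

lemma normal_form_rtranclp: "word_move\<^sup>*\<^sup>* w v \<Longrightarrow> normal_form w = normal_form v"
  by (induction rule: rtranclp_induct) (auto dest: normal_form_word_move)

text \<open>The normal form need not be traced through explicit moves: a word that is not reduced
  has a shortening move, which keeps the normal form, and a reduced word is its own normal
  form.\<close>

lemma word_move_normal_form: "word_move\<^sup>*\<^sup>* w (normal_form w)"
proof (induction w rule: length_induct)
  case (1 w)
  show ?case
  proof (cases "w = [] \<or> reduced_word w")
    case True
    then show ?thesis by (auto simp: normal_form_reduced) (simp add: normal_form_def)
  next
    case False
    then obtain v where v: "word_move w v" "length v < length w"
      using word_move_if_not_reduced by blast
    then show ?thesis
      using 1 normal_form_word_move[OF v(1)] by (metis converse_rtranclp_into_rtranclp)
  qed
qed

text \<open>A shortest reachable word admits no shortening move, so it equals its own normal form,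
  which is that of \<open>w\<close>. This is the uniqueness that the definite description in
  \<open>reduction\<close> rests on.\<close>

lemma is_arg_min_normal_form:
  "is_arg_min length (word_move\<^sup>*\<^sup>* w) v \<longleftrightarrow> v = normal_form w"
proof
  assume v: "is_arg_min length (word_move\<^sup>*\<^sup>* w) v"
  have "v = [] \<or> reduced_word v"
  proof (rule ccontr)
    assume "\<not> (v = [] \<or> reduced_word v)"
    then obtain u where "word_move v u" "length u < length v"
      using word_move_if_not_reduced by blast
    then show False using v by (auto simp: is_arg_min_def dest: rtranclp.rtrancl_into_rtrancl)
  qed
  then have "normal_form v = v"
    by (auto simp: normal_form_reduced) (simp add: normal_form_def)
  then show "v = normal_form w"
    using v normal_form_rtranclp[of w v] by (auto simp: is_arg_min_def)
next
  assume v: "v = normal_form w"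
  have "length v \<le> length u" if "word_move\<^sup>*\<^sup>* w u" for u
    using length_normal_form_le[of u] normal_form_rtranclp[OF that] v by simp
  then show "is_arg_min length (word_move\<^sup>*\<^sup>* w) v"
    using v word_move_normal_form[of w] unfolding is_arg_min_def linorder_not_less[symmetric] by blast
qed

lemma reduction_eq_normal_form: "reduction w = normal_form w"
  by (simp add: reduction_def is_arg_min_normal_form)

lemma word_move_reduction: "word_move\<^sup>*\<^sup>* w (reduction w)"
  by (simp add: reduction_eq_normal_form word_move_normal_form)

lemma reduction_eqI: "word_move\<^sup>*\<^sup>* w v \<Longrightarrow> reduction w = reduction v"
  by (simp add: reduction_eq_normal_form normal_form_rtranclp)

lemma reduction_reduced: "reduced_word w \<Longrightarrow> reduction w = w"
  by (simp add: reduction_eq_normal_form normal_form_reduced)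

lemma word_move_set: "word_move w v \<Longrightarrow> set v = set w"
  by (auto elim: word_move.cases)

lemma set_reduction [simp]: "set (reduction w) = set w"
proof -
  have "word_move\<^sup>*\<^sup>* w v \<Longrightarrow> set v = set w" for v
    by (induction rule: rtranclp_induct) (auto dest: word_move_set)
  then show ?thesis using word_move_reduction by blast
qed

lemma reduced_word_reduction:
  assumes "w \<noteq> []"
  shows "reduced_word (reduction w)"
proof (rule ccontr)
  assume "\<not> reduced_word (reduction w)"
  moreover have "reduction w \<noteq> []"
    using assms set_reduction[of w] by (metis set_empty)
  ultimately obtain u where "word_move (reduction w) u" "length u < length (reduction w)"
    using word_move_if_not_reduced by blast
  moreover have "is_arg_min length (word_move\<^sup>*\<^sup>* w) (reduction w)"
    by (simp add: is_arg_min_normal_form reduction_eq_normal_form)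
  ultimately show False
    by (auto simp: is_arg_min_def dest: rtranclp.rtrancl_into_rtrancl)
qed

lemma word_move_map: "word_move w v \<Longrightarrow> word_move (map f w) (map f v)"
  by (erule word_move.cases) (auto intro: word_move.intros[simplified])

text \<open>The reflexive closure is essential: if the repeated letter lies outside
  \<open>A\<close>, both restrictions coincide and no move is left.\<close>

lemma word_move_restrict:
  assumes "word_move w v"
  shows "word_move\<^sup>*\<^sup>* (word_restrict w A) (word_restrict v A)"
  using assms
proof cases
  case (contract xs a ys)
  then show ?thesis
    using word_move.contract[of "word_restrict xs A" a "word_restrict ys A"]
    by (auto simp: word_restrict_def)
next
  case (cyclic a xs)
  then show ?thesis
    using word_move.cyclic[of a "word_restrict xs A"]
    by (auto simp: word_restrict_def)
qed

lemma reduction_map_reduction: "reduction (map f (reduction w)) = reduction (map f w)"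
proof -
  have "word_move\<^sup>*\<^sup>* w v \<Longrightarrow> word_move\<^sup>*\<^sup>* (map f w) (map f v)" for v
    by (induction rule: rtranclp_induct)
      (auto intro: rtranclp.rtrancl_into_rtrancl word_move_map)
  then show ?thesis
    using reduction_eqI word_move_reduction by metis
qed

lemma reduction_restrict_reduction:
  "reduction (word_restrict (reduction w) A) = reduction (word_restrict w A)"
proof -
  have "word_move\<^sup>*\<^sup>* w v \<Longrightarrow> word_move\<^sup>*\<^sup>* (word_restrict w A) (word_restrict v A)" for v
    by (induction rule: rtranclp_induct)
      (auto intro: rtranclp_trans word_move_restrict)
  then show ?thesis
    using reduction_eqI word_move_reduction by metis
qed

lemma reduced_word_map:
  assumes "inj_on f (set w)" "reduced_word w"
  shows "reduced_word (map f w)"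
proof -
  have "hd (map f w) \<noteq> last (map f w)" if "w \<noteq> []" "hd w \<noteq> last w"
    using that assms(1) by (simp add: hd_map last_map inj_on_eq_iff)
  then show ?thesis
    using assms by (auto simp: reduced_word_iff distinct_adj_map_iff)
qed

text \<open>An injective relabeling of a reduced word is again reduced, so the further reduction in
  \<open>reduction_map_reduction\<close> does nothing.\<close>

lemma reduction_map_inj:
  assumes "inj_on f (set w)"
  shows "reduction (map f w) = map f (reduction w)"
proof (cases "w = []")
  case True
  have "reduction [] = []"
    using set_reduction[of "[]"] by (simp del: set_reduction)
  with True show ?thesis by (metis list.simps(8))
next
  case False
  then have "reduced_word (map f (reduction w))"
    using assms by (intro reduced_word_map reduced_word_reduction) auto
  then show ?thesis
    using reduction_map_reduction[of f w] reduction_reduced by metis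
qed

lemma words_map: "w \<in> words S \<Longrightarrow> inj_on f S \<Longrightarrow> map f w \<in> words (f ` S)"
  by (auto simp: words_def reduced_word_map)

lemma words_empty [simp]: "words {} = {}"
  by (auto simp: words_def reduced_word_def)

lemma reduction_words: "set w = S \<Longrightarrow> S \<noteq> {} \<Longrightarrow> reduction w \<in> words S"
  by (auto simp: words_def intro: reduced_word_reduction)

text \<open>Consecutive letters of \<open>p\<close> differ, so an embedding of \<open>p\<close> can
  use only one of two adjacent copies of \<open>c\<close>. The pattern a b a b is of this
  kind.\<close>

lemma subseq_contract:
  "distinct_adj p \<Longrightarrow> subseq p (xs @ [c, c] @ ys) \<Longrightarrow> subseq p (xs @ [c] @ ys)"
proof (induction xs arbitrary: p)
  case Nil
  then show ?case by (cases p; cases "tl p") (auto split: if_splits)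
next
  case (Cons x xs)
  then show ?case by (cases p) (auto simp: distinct_adj_Cons split: if_splits)
qed

lemma crossing_subseq: "crossing v \<Longrightarrow> subseq v w \<Longrightarrow> crossing w"
  unfolding crossing_def by (meson subseq_order.trans)

text \<open>If a pattern a b a b needs the final letter, then b is \<open>c\<close> and a b a lies
  before it. The initial \<open>c\<close> then completes the rotated pattern b a b a.\<close>

lemma crossing_cyclic:
  assumes "crossing (c # xs @ [c])"
  shows "crossing (c # xs)"
proof -
  obtain a b where ab: "a \<noteq> b" and s: "subseq [a, b, a, b] ((c # xs) @ [c])"
    using assms by (auto simp: crossing_def)
  show ?thesis
  proof (cases "subseq [a, b, a, b] (c # xs)")
    case False
    from s obtain p q where pq: "[a, b, a, b] = p @ q" "subseq p (c # xs)" "subseq q [c]"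
      by (rule subseq_appendE)
    have "q = [] \<or> q = [c]"
      using pq(3) by (cases q) (auto split: if_splits)
    then have "b = c" "subseq [a, b, a] (c # xs)"
      using pq False by (auto simp: append_eq_Cons_conv Cons_eq_append_conv)
    then have "subseq [b, a, b, a] (c # xs)"
      using ab by (simp split: if_splits)
    then show ?thesis using ab unfolding crossing_def by metis
  qed (use ab crossing_def in blast)
qed

lemma crossing_word_move:
  assumes "word_move w v"
  shows "crossing w = crossing v"
  using assms
proof cases
  case (contract xs a ys)
  have "subseq (xs @ [a] @ ys) (xs @ [a, a] @ ys)"
    by (simp add: subseq_append' list_emb_Cons)
  moreover have "crossing v" if w: "crossing w"
  proof -
    obtain b c where "b \<noteq> c" "subseq [b, c, b, c] w"
      using w by (auto simp: crossing_def)
    then have "subseq [b, c, b, c] v"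
      using contract subseq_contract[of "[b, c, b, c]" xs a ys] by simp
    then show ?thesis
      using \<open>b \<noteq> c\<close> unfolding crossing_def by blast
  qed
  ultimately show ?thesis
    using contract crossing_subseq[of v w] by metis
next
  case (cyclic c xs)
  have "subseq (c # xs) (c # xs @ [c])"
    using subseq_rev_drop_many[of "c # xs" "c # xs" "[c]"] by simp
  then show ?thesis
    using cyclic crossing_cyclic[of c xs] crossing_subseq[of v w] by metis
qed

lemma crossing_reduction [simp]: "crossing (reduction w) = crossing w"
proof -
  have "word_move\<^sup>*\<^sup>* w v \<Longrightarrow> crossing v = crossing w" for v
    by (induction rule: rtranclp_induct) (auto dest: crossing_word_move)
  then show ?thesis using word_move_reduction by blast
qed

lemma crossing_letters: "subseq [a, b, a, b] w \<Longrightarrow> a \<in> set w \<and> b \<in> set w"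
  using list_emb_set[of "(=)" "[a, b, a, b]" w a] list_emb_set[of "(=)" "[a, b, a, b]" w b] by auto

lemma crossing_map:
  assumes "inj_on f (set w)" "crossing w"
  shows "crossing (map f w)"
proof -
  obtain a b where ab: "a \<noteq> b" "subseq [a, b, a, b] w"
    using assms(2) by (auto simp: crossing_def)
  then have "subseq [f a, f b, f a, f b] (map f w)"
    using subseq_map[of "[a, b, a, b]" w f] by simp
  moreover have "f a \<noteq> f b"
    using ab assms(1) crossing_letters[OF ab(2)] by (auto simp: inj_on_eq_iff)
  ultimately show ?thesis by (auto simp: crossing_def)
qed

lemma crossing_map_iff:
  assumes "inj_on f (set w)"
  shows "crossing (map f w) = crossing w"
proof
  assume "crossing (map f w)"
  then have "crossing (map (inv_into (set w) f) (map f w))"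
    using crossing_map[of "inv_into (set w) f" "map f w"] by (simp add: inj_on_inv_into)
  moreover have "map (inv_into (set w) f) (map f w) = w"
    using assms by (simp add: map_idI)
  ultimately show "crossing w" by simp
qed (use assms crossing_map in blast)

lemma crossing_image_or_fiber:
  assumes "crossing w"
  shows "crossing (map f w) \<or> (\<exists>t\<in>f ` set w. crossing (word_restrict w (fiber (set w) f t)))"
proof -
  obtain a b where ab: "a \<noteq> b" "subseq [a, b, a, b] w"
    using assms by (auto simp: crossing_def)
  show ?thesis
  proof (cases "f a = f b")
    case False
    then show ?thesis
      using subseq_map[OF ab(2), of f] by (auto simp: crossing_def)
  next
    case True
    have "subseq [a, b, a, b] (word_restrict w (fiber (set w) f (f a)))"
      using subseq_filter[OF ab(2), of "\<lambda>x. x \<in> fiber (set w) f (f a)"] crossing_letters[OF ab(2)] True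
      by (auto simp: word_restrict_def fiber_def)
    then have "crossing (word_restrict w (fiber (set w) f (f a)))"
      using ab(1) by (auto simp: crossing_def)
    then show ?thesis
      using crossing_letters[OF ab(2)] by blast
  qed
qed

section \<open>Linear maps on spans of basis vectors and their tensor products\<close>

lemma sum_fun_apply: "(\<Sum>i\<in>I. f i) x = (\<Sum>i\<in>I. f i x)"
  by (induction I rule: infinite_finite_induct) (auto simp: plus_fun_apply)

text \<open>As a rewrite rule, \<open>plus_fun_apply\<close> also eta-expands unapplied sums of functions.\<close>

declare plus_fun_apply [simp del]

lemma fscale_apply: "fscale c x b = c * x b"
  by (simp add: fscale_def)

lemma lin_ext_apply: "lin_ext m x z = (\<Sum>b | x b \<noteq> 0. x b * m b z)"
  by (simp add: lin_ext_def sum_fun_apply fscale_apply)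

lemma lin_ext_apply_superset:
  assumes "finite F" "\<And>b. x b \<noteq> 0 \<Longrightarrow> b \<in> F"
  shows "lin_ext m x z = (\<Sum>b\<in>F. x b * m b z)"
  unfolding lin_ext_apply using assms by (intro sum.mono_neutral_left) auto

lemma lin_ext_cong: "(\<And>b. x b \<noteq> 0 \<Longrightarrow> m b = m' b) \<Longrightarrow> lin_ext m x = lin_ext m' x"
  by (simp add: lin_ext_def)

lemma lin_ext_delta [simp]: "lin_ext m (delta b) = m b"
proof
  fix z
  have "lin_ext m (delta b) z = (\<Sum>b'\<in>{b}. delta b b' * m b' z)"
    by (rule lin_ext_apply_superset) (auto simp: delta_def split: if_splits)
  then show "lin_ext m (delta b) z = m b z"
    by (simp add: delta_def)
qed

lemma lin_ext_zero [simp]: "lin_ext m 0 = 0"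
  by (simp add: lin_ext_def)

text \<open>Turns membership in a span of basis vectors into a condition on the support, the form in
  which spans are used below.\<close>

lemma span_delta:
  "fun_space.span (delta ` B) = {x :: 'b \<Rightarrow> 'k::field. finite {b. x b \<noteq> 0} \<and> (\<forall>b. x b \<noteq> 0 \<longrightarrow> b \<in> B)}"
  (is "_ = ?V")
proof
  have "finite {b. x b + y b \<noteq> 0}" if "finite {b. x b \<noteq> 0}" "finite {b. y b \<noteq> 0}"
    for x y :: "'b \<Rightarrow> 'k"
    using that by (intro finite_subset[OF _ finite_UnI[OF that]]) auto
  moreover have "finite {b. c * x b \<noteq> 0}" if "finite {b. x b \<noteq> 0}" for c and x :: "'b \<Rightarrow> 'k"
    using that by (intro finite_subset[OF _ that]) auto
  moreover have "x b \<noteq> 0 \<or> y b \<noteq> 0" if "x b + y b \<noteq> 0" for x y :: "'b \<Rightarrow> 'k" and b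
    using that by auto
  ultimately have "fun_space.subspace ?V"
    unfolding fun_space.subspace_def by (auto simp: fscale_apply plus_fun_apply) metis
  then show "fun_space.span (delta ` B) \<subseteq> ?V"
    by (intro fun_space.span_minimal) (auto simp: delta_def split: if_splits)
next
  show "?V \<subseteq> fun_space.span (delta ` B)"
  proof
    fix x assume x: "x \<in> ?V"
    \<comment> \<open>The expansion of \<open>x\<close> in basis vectors, a sum over its finite
      support.\<close>
    have "x = lin_ext delta x"
    proof
      fix c
      show "x c = lin_ext delta x c"
        using x by (simp add: lin_ext_apply delta_def if_distrib cong: if_cong)
    qed
    also have "\<dots> \<in> fun_space.span (delta ` B)"
      unfolding lin_ext_def using x
      by (intro fun_space.span_sum fun_space.span_scale fun_space.span_base) auto
    finally show "x \<in> fun_space.span (delta ` B)" .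
  qed
qed

lemma span_delta_nonzeroD: "x \<in> fun_space.span (delta ` B) \<Longrightarrow> x b \<noteq> 0 \<Longrightarrow> b \<in> B"
  by (simp add: span_delta)

lemma span_delta_mono: "B \<subseteq> C \<Longrightarrow> fun_space.span (delta ` B) \<subseteq> fun_space.span (delta ` C)"
  by (intro fun_space.span_mono image_mono)

lemma delta_in_span [simp]: "b \<in> B \<Longrightarrow> delta b \<in> fun_space.span (delta ` B)"
  by (intro fun_space.span_base) simp

lemma lin_ext_in_subspace:
  assumes "fun_space.subspace U" "\<And>b. x b \<noteq> 0 \<Longrightarrow> m b \<in> U"
  shows "lin_ext m x \<in> U"
  unfolding lin_ext_def using assms
  by (intro fun_space.subspace_sum fun_space.subspace_scale) auto

lemma linear_on_add: "linear_on V L \<Longrightarrow> x \<in> V \<Longrightarrow> y \<in> V \<Longrightarrow> L (x + y) = L x + L y"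
  by (simp add: linear_on_def)

lemma linear_on_scale: "linear_on V L \<Longrightarrow> x \<in> V \<Longrightarrow> L (fscale c x) = fscale c (L x)"
  by (simp add: linear_on_def)

lemma linear_on_zero:
  assumes "linear_on V L" "fun_space.subspace V"
  shows "L 0 = 0"
  using linear_on_scale[OF assms(1) fun_space.subspace_0[OF assms(2)], of 0] by simp

lemma linear_on_id: "linear_on V (\<lambda>x. x)"
  by (simp add: linear_on_def)

lemma linear_on_cong:
  assumes "linear_on V L" "fun_space.subspace V" "\<And>x. x \<in> V \<Longrightarrow> L' x = L x"
  shows "linear_on V L'"
  using assms(1,3) fun_space.subspace_add[OF assms(2)] fun_space.subspace_scale[OF assms(2)]
  by (simp add: linear_on_def)

lemma linear_on_sum:
  assumes "linear_on V L" "fun_space.subspace V" "\<And>i. i \<in> I \<Longrightarrow> f i \<in> V"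
  shows "L (\<Sum>i\<in>I. f i) = (\<Sum>i\<in>I. L (f i))"
  using assms(3)
proof (induction I rule: infinite_finite_induct)
  case (insert i I)
  then show ?case
    using linear_on_add[OF assms(1), of "f i" "sum f I"] fun_space.subspace_sum[OF assms(2), of I f] by simp
qed (use linear_on_zero[OF assms(1,2)] in auto)

lemma linear_on_lin_ext_commute:
  assumes "linear_on V L" "fun_space.subspace V" "\<And>b. x b \<noteq> 0 \<Longrightarrow> m b \<in> V"
  shows "L (lin_ext m x) = lin_ext (\<lambda>b. L (m b)) x"
proof -
  have "L (lin_ext m x) = (\<Sum>b | x b \<noteq> 0. L (fscale (x b) (m b)))"
    unfolding lin_ext_def using assms
    by (intro linear_on_sum[OF assms(1,2)] fun_space.subspace_scale) auto
  also have "\<dots> = lin_ext (\<lambda>b. L (m b)) x"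
    unfolding lin_ext_def using assms by (intro sum.cong) (auto intro!: linear_on_scale[OF assms(1)])
  finally show ?thesis .
qed

text \<open>\<open>lin_ext\<close> sums over the support of its argument, which varies and may
  shrink under addition. The three sums are compared over the union of the supports of the summands,
  finite for vectors in the span.\<close>

lemma linear_on_lin_ext:
  fixes m :: "'b \<Rightarrow> 'c \<Rightarrow> 'k::field"
  shows "linear_on (fun_space.span (delta ` B)) (lin_ext m)"
  unfolding linear_on_def
proof (intro conjI ballI allI ext)
  fix x y :: "'b \<Rightarrow> 'k" and z
  assume "x \<in> fun_space.span (delta ` B)" "y \<in> fun_space.span (delta ` B)"
  then have F: "finite ({b. x b \<noteq> 0} \<union> {b. y b \<noteq> 0})" (is "finite ?F")
    by (simp add: span_delta)
  show "lin_ext m (x + y) z = (lin_ext m x + lin_ext m y) z"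
  proof -
    have "lin_ext m (x + y) z = (\<Sum>b\<in>?F. (x + y) b * m b z)"
      using F by (rule lin_ext_apply_superset) (auto simp: plus_fun_apply)
    moreover have "lin_ext m x z = (\<Sum>b\<in>?F. x b * m b z)" "lin_ext m y z = (\<Sum>b\<in>?F. y b * m b z)"
      using F by (auto intro!: lin_ext_apply_superset)
    ultimately show ?thesis
      by (simp add: sum.distrib distrib_right plus_fun_apply)
  qed
next
  fix x :: "'b \<Rightarrow> 'k" and c z
  assume "x \<in> fun_space.span (delta ` B)"
  then have F: "finite {b. x b \<noteq> 0}"
    by (simp add: span_delta)
  show "lin_ext m (fscale c x) z = fscale c (lin_ext m x) z"
    using lin_ext_apply_superset[OF F, of x m z] lin_ext_apply_superset[OF F, of "fscale c x" m z]
    by (auto simp: sum_distrib_left mult.assoc fscale_apply)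
qed

lemma linear_on_span_eqI:
  assumes "linear_on (fun_space.span B) L" "linear_on (fun_space.span B) L'"
    and "\<And>b. b \<in> B \<Longrightarrow> L b = L' b" "x \<in> fun_space.span B"
  shows "L x = L' x"
proof -
  have "x \<in> fun_space.span B \<and> L x = L' x"
    using assms(4)
  proof (induction rule: fun_space.span_induct_alt)
    case base
    then show ?case
      using linear_on_zero assms(1,2) fun_space.subspace_span fun_space.span_zero by metis
  next
    case (step c b y)
    have "fscale c b \<in> fun_space.span B" and "b \<in> fun_space.span B"
      using step by (auto intro: fun_space.span_base fun_space.span_scale)
    then show ?case
      using step linear_on_add[OF assms(1), of "fscale c b" y] linear_on_add[OF assms(2), of "fscale c b" y]
        linear_on_scale[OF assms(1), of b c] linear_on_scale[OF assms(2), of b c] assms(3)[of b]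
      by (simp add: fun_space.span_add)
  qed
  then show ?thesis by simp
qed

lemma linear_on_eq_lin_ext:
  assumes "linear_on (fun_space.span (delta ` B)) L" "x \<in> fun_space.span (delta ` B)"
  shows "L x = lin_ext (\<lambda>b. L (delta b)) x"
  by (rule linear_on_span_eqI[OF assms(1) linear_on_lin_ext _ assms(2)]) auto

lemma lin_ext_delta_eq:
  "x \<in> fun_space.span (delta ` B) \<Longrightarrow> lin_ext delta x = x"
  by (rule linear_on_eq_lin_ext[OF linear_on_id, symmetric])

lemma linear_on_apply:
  assumes "linear_on (fun_space.span (delta ` B)) L" "x \<in> fun_space.span (delta ` B)"
  shows "L x z = (\<Sum>b | x b \<noteq> 0. x b * L (delta b) z)"
  using linear_on_eq_lin_ext[OF assms] by (simp add: lin_ext_apply)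

section \<open>Linear maps on tensor products\<close>

lemma subspace_tensor: "fun_space.subspace (tensor V T W)"
  by (simp add: tensor_def)

lemma pure_in_tensor: "x \<in> V \<Longrightarrow> (\<And>t. t \<in> T \<Longrightarrow> y t \<in> W t) \<Longrightarrow> pure T x y \<in> tensor V T W"
  unfolding tensor_def by (intro fun_space.span_base) auto

text \<open>Two linear maps with the same values on pure tensors agree on their span, but may differ
  outside it. The description therefore fixes the value at \<open>\<tau>\<close>, not the map, and
  any suitable \<open>L\<close> computes it.\<close>

lemma tensor_lift_unique:
  assumes L: "linear_on (tensor V T W) L"
    and m: "\<And>x y. x \<in> V \<Longrightarrow> (\<And>t. t \<in> T \<Longrightarrow> y t \<in> W t) \<Longrightarrow> L (pure T x y) = m x y"
    and \<tau>: "\<tau> \<in> tensor V T W"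
  shows "tensor_lift V T W m \<tau> = L \<tau>"
  unfolding tensor_lift_def
proof (rule the_equality)
  show "\<exists>L'. linear_on (tensor V T W) L' \<and>
          (\<forall>x y. x \<in> V \<and> (\<forall>t\<in>T. y t \<in> W t) \<longrightarrow> L' (pure T x y) = m x y) \<and> L \<tau> = L' \<tau>"
    using L m by blast
next
  fix z
  assume "\<exists>L. linear_on (tensor V T W) L \<and>
          (\<forall>x y. x \<in> V \<and> (\<forall>t\<in>T. y t \<in> W t) \<longrightarrow> L (pure T x y) = m x y) \<and> z = L \<tau>"
  then obtain L' where L': "linear_on (tensor V T W) L'" "z = L' \<tau>"
      "\<And>x y. x \<in> V \<Longrightarrow> (\<forall>t\<in>T. y t \<in> W t) \<Longrightarrow> L' (pure T x y) = m x y"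
    by blast
  have "L' \<tau> = L \<tau>"
    by (rule linear_on_span_eqI[OF L'(1)[unfolded tensor_def] L[unfolded tensor_def] _ \<tau>[unfolded tensor_def]])
      (use L'(3) m in auto)
  then show "z = L \<tau>" using L' by simp
qed

context
  fixes T :: "'t set" and V :: "('b \<Rightarrow> 'k::field) set" and W :: "'t \<Rightarrow> ('c \<Rightarrow> 'k) set"
    and P :: "'b set" and Q :: "'t \<Rightarrow> 'c set"
  assumes fin: "finite T"
    and V: "V = fun_space.span (delta ` P)"
    and W: "\<And>t. t \<in> T \<Longrightarrow> W t = fun_space.span (delta ` Q t)"
begin

text \<open>
  Tensors do not depend on the coordinates outside \<open>T\<close>, so they have finite support only after
  restriction to extensional coordinate families.
\<close>

definition canonical_part :: "('b \<times> ('t \<Rightarrow> 'c) \<Rightarrow> 'k) \<Rightarrow> 'b \<times> ('t \<Rightarrow> 'c) \<Rightarrow> 'k" where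
  "canonical_part \<tau> = (\<lambda>(b, c). if c \<in> extensional T then \<tau> (b, c) else 0)"

text \<open>A finite product in a field is nonzero only if every factor is. This product shape of
  the support is what later lets a sum over it factor.\<close>

lemma canonical_part_pure_support:
  "{p. canonical_part (pure T x y) p \<noteq> 0} =
     {b. x b \<noteq> 0} \<times> Pi\<^sub>E T (\<lambda>t. {c. y t c \<noteq> 0})"
proof (rule set_eqI)
  fix p :: "'b \<times> ('t \<Rightarrow> 'c)"
  obtain b c where "p = (b, c)" by (cases p)
  then show "p \<in> {p. canonical_part (pure T x y) p \<noteq> 0} \<longleftrightarrow>
      p \<in> {b. x b \<noteq> 0} \<times> Pi\<^sub>E T (\<lambda>t. {c. y t c \<noteq> 0})"
    using fin by (simp add: canonical_part_def pure_def PiE_iff)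
qed

lemma linear_on_canonical_part: "linear_on X canonical_part"
  by (auto simp: linear_on_def canonical_part_def fun_eq_iff plus_fun_apply fscale_apply)

lemma canonical_part_finite:
  assumes "\<tau> \<in> tensor V T W"
  shows "canonical_part \<tau> \<in> fun_space.span (delta ` UNIV)"
  using assms unfolding tensor_def
proof (induction rule: fun_space.span_induct_alt)
  case base
  show ?case
    using fun_space.span_zero linear_on_zero[OF linear_on_canonical_part fun_space.subspace_UNIV] by metis
next
  case (step c p \<tau>)
  then obtain x y where p: "p = pure T x y" "x \<in> V" "\<forall>t\<in>T. y t \<in> W t"
    by blast
  have "finite {q. canonical_part p q \<noteq> 0}"
    unfolding p(1) canonical_part_pure_support
    using p fin by (intro finite_cartesian_product finite_PiE) (auto simp: V W span_delta)
  then have "canonical_part p \<in> fun_space.span (delta ` UNIV)"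
    by (simp add: span_delta)
  then show ?case
    using step linear_on_add[OF linear_on_canonical_part[of UNIV], of "fscale c p" \<tau>]
      linear_on_scale[OF linear_on_canonical_part[of UNIV], of p c]
    by (simp add: fun_space.span_add fun_space.span_scale)
qed

text \<open>Supplies the existence half for multilinear maps whose coordinates are products of one
  value of \<open>A\<close> and one value of each \<open>B t\<close>. The selectors \<open>p\<close>
  and \<open>r\<close> say which coordinates of the target are read, so that a permutation of the
  tensor factors is covered as well as a factorwise map.\<close>

lemma tensor_lift_product:
  fixes A :: "('b \<Rightarrow> 'k) \<Rightarrow> 'e \<Rightarrow> 'k" and B :: "'t \<Rightarrow> ('c \<Rightarrow> 'k) \<Rightarrow> 'f \<Rightarrow> 'k"
  assumes A: "linear_on V A" and B: "\<And>t. t \<in> T \<Longrightarrow> linear_on (W t) (B t)"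
    and m: "\<And>x y d. x \<in> V \<Longrightarrow> (\<And>t. t \<in> T \<Longrightarrow> y t \<in> W t) \<Longrightarrow>
              m x y d = A x (p d) * (\<Prod>t\<in>T. B t (y t) (r d t))"
  shows "linear_on (tensor V T W) (tensor_lift V T W m)"
    and "x \<in> V \<Longrightarrow> (\<And>t. t \<in> T \<Longrightarrow> y t \<in> W t) \<Longrightarrow>
           tensor_lift V T W m (pure T x y) = m x y"
proof -
  \<comment> \<open>The prescribed values on tensors of basis vectors; their linear extension, after
    discarding redundant coordinates, is the required map.\<close>
  define K where "K = (\<lambda>(b, c) d. A (delta b) (p d) * (\<Prod>t\<in>T. B t (delta (c t)) (r d t)))"
  define L where "L \<tau> = lin_ext K (canonical_part \<tau>)" for \<tau>
  have linear: "linear_on (tensor V T W) L"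
    unfolding linear_on_def
  proof (intro conjI ballI allI)
    fix \<tau> \<tau>' assume "\<tau> \<in> tensor V T W" "\<tau>' \<in> tensor V T W"
    then show "L (\<tau> + \<tau>') = L \<tau> + L \<tau>'"
      unfolding L_def
      using linear_on_add[OF linear_on_lin_ext canonical_part_finite canonical_part_finite]
        linear_on_add[OF linear_on_canonical_part[of UNIV]]
      by (metis UNIV_I)
  next
    fix c \<tau> assume "\<tau> \<in> tensor V T W"
    then show "L (fscale c \<tau>) = fscale c (L \<tau>)"
      unfolding L_def
      using linear_on_scale[OF linear_on_lin_ext canonical_part_finite]
        linear_on_scale[OF linear_on_canonical_part[of UNIV]]
      by (metis UNIV_I)
  qed
  have pure: "L (pure T x y) = m x y" if x: "x \<in> V" and y: "\<And>t. t \<in> T \<Longrightarrow> y t \<in> W t" for x y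
  proof
    fix d
    let ?X = "{b. x b \<noteq> 0}" and ?Y = "\<lambda>t. {c. y t c \<noteq> 0}"
    have finY: "finite (?Y t)" if "t \<in> T" for t
      using y[OF that] W[OF that] by (simp add: span_delta)
    have "L (pure T x y) d =
        (\<Sum>q\<in>?X \<times> Pi\<^sub>E T ?Y. canonical_part (pure T x y) q * K q d)"
      by (simp add: L_def lin_ext_apply canonical_part_pure_support)
    also have "\<dots> = (\<Sum>q\<in>?X \<times> Pi\<^sub>E T ?Y. (x (fst q) * A (delta (fst q)) (p d)) *
        (\<Prod>t\<in>T. y t (snd q t) * B t (delta (snd q t)) (r d t)))"
      by (intro sum.cong)
        (auto simp: canonical_part_def pure_def K_def prod.distrib PiE_iff)
    also have "\<dots> = (\<Sum>b\<in>?X. x b * A (delta b) (p d)) *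
        (\<Sum>c\<in>Pi\<^sub>E T ?Y. \<Prod>t\<in>T. y t (c t) * B t (delta (c t)) (r d t))"
      by (simp add: sum_product sum.cartesian_product case_prod_beta)
    \<comment> \<open>Distributivity: a sum over all choices of one basis index per \<open>t\<close>
      is a product of sums, each of which is an expansion of \<open>B t (y t)\<close> in
      coordinates.\<close>
    also have "(\<Sum>c\<in>Pi\<^sub>E T ?Y. \<Prod>t\<in>T. y t (c t) * B t (delta (c t)) (r d t)) =
        (\<Prod>t\<in>T. \<Sum>c\<in>?Y t. y t c * B t (delta c) (r d t))"
      using fin finY by (intro prod_sum_PiE[symmetric]) auto
    also have "\<dots> = (\<Prod>t\<in>T. B t (y t) (r d t))"
    proof (rule prod.cong[OF refl])
      fix t assume "t \<in> T"
      then show "(\<Sum>c\<in>?Y t. y t c * B t (delta c) (r d t)) = B t (y t) (r d t)"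
        using linear_on_apply[of "Q t" "B t" "y t"] B y W by simp
    qed
    also have "(\<Sum>b\<in>?X. x b * A (delta b) (p d)) = A x (p d)"
      using x by (intro linear_on_apply[symmetric, OF A[unfolded V]]) (simp add: V)
    finally show "L (pure T x y) d = m x y d"
      using m x y by simp
  qed
  have eq: "tensor_lift V T W m \<tau> = L \<tau>" if "\<tau> \<in> tensor V T W" for \<tau>
    using linear pure that by (rule tensor_lift_unique)
  then show "linear_on (tensor V T W) (tensor_lift V T W m)"
    using linear_on_cong[OF linear subspace_tensor] by blast
  show "tensor_lift V T W m (pure T x y) = m x y"
    if "x \<in> V" "\<And>t. t \<in> T \<Longrightarrow> y t \<in> W t"
    using that by (simp add: eq pure pure_in_tensor)
qed

lemma tensor_map:
  assumes "linear_on V A" "\<And>t. t \<in> T \<Longrightarrow> linear_on (W t) (B t)"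
  shows linear_on_tensor_map: "linear_on (tensor V T W) (tensor_map V T W A B)"
    and tensor_map_pure: "x \<in> V \<Longrightarrow> (\<And>t. t \<in> T \<Longrightarrow> y t \<in> W t) \<Longrightarrow>
           tensor_map V T W A B (pure T x y) = pure T (A x) (\<lambda>t. B t (y t))"
proof -
  let ?m = "\<lambda>x y. pure T (A x) (\<lambda>t. B t (y t))"
  have m: "?m x y d = A x (fst d) * (\<Prod>t\<in>T. B t (y t) (snd d t))" for x y d
    by (simp add: pure_def case_prod_beta)
  show "linear_on (tensor V T W) (tensor_map V T W A B)"
    unfolding tensor_map_def by (rule tensor_lift_product(1)[where m = ?m, OF assms m])
  show "tensor_map V T W A B (pure T x y) = ?m x y" if "x \<in> V" "\<And>t. t \<in> T \<Longrightarrow> y t \<in> W t"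
    unfolding tensor_map_def by (rule tensor_lift_product(2)[where m = ?m, OF assms m that])
qed

end

section \<open>The non-crossing quotient\<close>

text \<open>A common form of W, X and N, so that the species axioms are checked once, for any
  property of words stable under injective relabeling.\<close>

definition word_subspecies :: "('a list \<Rightarrow> bool) \<Rightarrow> ('a, 'a list, 'k::field) species" where
  "word_subspecies P =
     \<lparr>val = (\<lambda>S. fun_space.span (delta ` {w \<in> words S. P w})), act = relabel\<rparr>"

lemma word_species_eq: "word_species = word_subspecies (\<lambda>w. True)"
  and crossing_species_eq: "crossing_species = word_subspecies crossing"
  and noncrossing_species_eq: "noncrossing_species = word_subspecies (\<lambda>w. \<not> crossing w)"
  by (simp_all add: word_species_def crossing_species_def noncrossing_species_def word_subspecies_def)

lemma val_word_subspecies: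
  "val (word_subspecies P) S = fun_space.span (delta ` {w \<in> words S. P w})"
  and act_word_subspecies [simp]: "act (word_subspecies P) = relabel"
  by (simp_all add: word_subspecies_def)

lemma subspace_val_word_subspecies [simp]: "fun_space.subspace (val (word_subspecies P) S)"
  by (simp add: val_word_subspecies)

lemma delta_in_val: "w \<in> words S \<Longrightarrow> P w \<Longrightarrow> delta w \<in> val (word_subspecies P) S"
  by (simp add: val_word_subspecies)

lemma val_nonzeroD:
  assumes "x \<in> val (word_subspecies P) S" "x w \<noteq> 0"
  shows "w \<in> words S" "P w"
  using span_delta_nonzeroD[OF assms[unfolded val_word_subspecies]] by auto

lemma val_empty: "val (word_subspecies P) {} = {0}"
  by (simp add: val_word_subspecies)

lemma linear_on_val_lin_ext: "linear_on (val (word_subspecies P) S) (lin_ext m)"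
  unfolding val_word_subspecies by (rule linear_on_lin_ext)

lemma lin_ext_lin_ext:
  assumes "\<And>b. x b \<noteq> 0 \<Longrightarrow> n b \<in> fun_space.span (range delta)"
  shows "lin_ext m (lin_ext n x) = lin_ext (\<lambda>b. lin_ext m (n b)) x"
  by (rule linear_on_lin_ext_commute[OF linear_on_lin_ext fun_space.subspace_span assms])

lemma relabel_delta [simp]: "relabel \<sigma> S (delta w) = delta (map \<sigma> w)"
  by (simp add: relabel_def)

lemma relabel_in_val:
  assumes P: "\<And>\<sigma> w. inj_on \<sigma> (set w) \<Longrightarrow> P w \<Longrightarrow> P (map \<sigma> w)"
    and \<sigma>: "inj_on \<sigma> S" and x: "x \<in> val (word_subspecies P) S"
  shows "relabel \<sigma> S x \<in> val (word_subspecies P) (\<sigma> ` S)"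
  unfolding relabel_def
proof (rule lin_ext_in_subspace[OF subspace_val_word_subspecies])
  fix w assume "x w \<noteq> 0"
  with x have w: "w \<in> words S" "P w"
    by (auto dest: val_nonzeroD)
  then have "P (map \<sigma> w)"
    using P \<sigma> by (auto simp: words_def)
  then show "delta (map \<sigma> w) \<in> val (word_subspecies P) (\<sigma> ` S)"
    using w \<sigma> by (intro delta_in_val words_map)
qed

lemma is_species_word_subspecies:
  assumes P: "\<And>\<sigma> w. inj_on \<sigma> (set w) \<Longrightarrow> P w \<Longrightarrow> P (map \<sigma> w)"
  shows "is_species (word_subspecies P :: ('a, 'a list, 'k::field) species)" (is "is_species ?F")
  unfolding is_species_def act_word_subspecies
proof (intro conjI allI impI ballI; (elim conjE)?)
  fix S :: "'a set" and \<sigma> :: "'a \<Rightarrow> 'a"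
  show "linear_on (val ?F S) (relabel \<sigma> S)"
    unfolding relabel_def by (rule linear_on_val_lin_ext)
next
  fix S and \<sigma> :: "'a \<Rightarrow> 'a" assume "inj_on \<sigma> S"
  then show "relabel \<sigma> S \<in> val ?F S \<rightarrow> val ?F (\<sigma> ` S)"
    using relabel_in_val[of P] P by blast
next
  fix S and \<sigma> \<sigma>' :: "'a \<Rightarrow> 'a" and x :: "'a list \<Rightarrow> 'k"
  assume "\<forall>s\<in>S. \<sigma> s = \<sigma>' s" "x \<in> val ?F S"
  then show "relabel \<sigma> S x = relabel \<sigma>' S x"
    unfolding relabel_def
    by (intro lin_ext_cong arg_cong[of _ _ delta] map_cong refl) (auto simp: words_def dest: val_nonzeroD(1))
next
  fix S and x :: "'a list \<Rightarrow> 'k" assume "x \<in> val ?F S"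
  then show "relabel id S x = x"
    by (simp add: relabel_def val_word_subspecies lin_ext_delta_eq)
next
  fix S and \<sigma> \<rho> :: "'a \<Rightarrow> 'a" and x :: "'a list \<Rightarrow> 'k"
  have "relabel \<rho> (\<sigma> ` S) (relabel \<sigma> S x) = lin_ext (\<lambda>w. delta (map \<rho> (map \<sigma> w))) x"
    unfolding relabel_def by (subst lin_ext_lin_ext) auto
  then show "relabel (\<rho> \<circ> \<sigma>) S x = relabel \<rho> (\<sigma> ` S) (relabel \<sigma> S x)"
    by (simp add: relabel_def)
qed simp

text \<open>The image of a basis word in the quotient N. Putting it in place of \<open>delta\<close>
  in a formula on words composes that formula with the quotient map.\<close>

definition nc_delta :: "'a list \<Rightarrow> 'a list \<Rightarrow> 'k::field" where
  "nc_delta w = (if crossing w then 0 else delta w)"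

abbreviation (input) noncrossing :: "'a list \<Rightarrow> bool" where
  "noncrossing w \<equiv> \<not> crossing w"

lemma nc_delta_in_val: "w \<in> words S \<Longrightarrow> nc_delta w \<in> val (word_subspecies noncrossing) S"
  by (simp add: nc_delta_def delta_in_val fun_space.subspace_0)

lemma nc_delta_in_span: "nc_delta w \<in> fun_space.span (range delta)"
  by (simp add: nc_delta_def fun_space.span_zero)

lemma noncrossing_quotient_eq: "noncrossing_quotient S = lin_ext nc_delta"
  by (simp add: noncrossing_quotient_def nc_delta_def[abs_def])

lemma relabel_nc_delta: "inj_on \<sigma> (set w) \<Longrightarrow> relabel \<sigma> S (nc_delta w) = nc_delta (map \<sigma> w)"
  by (simp add: nc_delta_def crossing_map_iff) (simp add: relabel_def)

text \<open>The quotient map is a coordinate projection, so its image and kernel can be read off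
  from supports.\<close>

lemma noncrossing_quotient_apply:
  assumes "x \<in> val (word_subspecies P) S"
  shows "noncrossing_quotient S x w = (if crossing w then 0 else x w)"
proof -
  have fin: "finite {w. x w \<noteq> 0}"
    using assms by (simp add: val_word_subspecies span_delta)
  have "noncrossing_quotient S x w = (\<Sum>v | x v \<noteq> 0. if v = w then (if crossing w then 0 else x w) else 0)"
    unfolding noncrossing_quotient_eq lin_ext_apply
    by (intro sum.cong) (auto simp: nc_delta_def delta_def)
  then show ?thesis
    using fin by simp
qed

text \<open>The projection is the identity on N, hence onto, and its kernel consists of the vectors
  supported on crossing words. It is natural because injective relabelings preserve and reflect
  crossings.\<close>

lemma is_quotient_map_noncrossing:
  "is_quotient_map (word_species :: ('a, 'a list, 'k::field) species)
     crossing_species noncrossing_species noncrossing_quotient"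
proof -
  let ?W = "word_subspecies (\<lambda>w. True) :: ('a, 'a list, 'k) species"
  let ?X = "word_subspecies crossing :: ('a, 'a list, 'k) species"
  let ?N = "word_subspecies noncrossing :: ('a, 'a list, 'k) species"
  have sub: "val (word_subspecies P) S \<subseteq> val ?W S" for P S
    unfolding val_word_subspecies by (rule span_delta_mono) auto
  have in_N: "noncrossing_quotient S x \<in> val ?N S" if "x \<in> val ?W S" for x S
    unfolding noncrossing_quotient_eq using that
    by (intro lin_ext_in_subspace nc_delta_in_val) (auto dest: val_nonzeroD)
  have retract: "noncrossing_quotient S x = x" if "x \<in> val ?N S" for x S
    using noncrossing_quotient_apply[OF that] val_nonzeroD(2)[OF that] by fastforce
  have "species_hom ?X ?W id_hom"
    by (auto simp: species_hom_def id_hom_def linear_on_def intro: subsetD[OF sub])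
  moreover have "species_hom ?W ?N noncrossing_quotient"
    unfolding species_hom_def act_word_subspecies
  proof (intro conjI allI impI ballI; (elim conjE)?)
    fix S show "linear_on (val ?W S) (noncrossing_quotient S)"
      unfolding noncrossing_quotient_eq by (rule linear_on_val_lin_ext)
  next
    fix S and \<sigma> :: "'a \<Rightarrow> 'a" and x :: "'a list \<Rightarrow> 'k"
    assume "inj_on \<sigma> S" and x: "x \<in> val ?W S"
    then have "relabel \<sigma> S (nc_delta w) = (nc_delta (map \<sigma> w) :: 'a list \<Rightarrow> 'k)" if "x w \<noteq> 0" for w
      using val_nonzeroD(1)[OF x that] by (simp add: relabel_nc_delta words_def)
    moreover have "relabel \<sigma> S (noncrossing_quotient S x) = lin_ext (\<lambda>w. relabel \<sigma> S (nc_delta w)) x"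
      unfolding noncrossing_quotient_eq relabel_def
      by (rule lin_ext_lin_ext) (rule nc_delta_in_span)
    moreover have "noncrossing_quotient (\<sigma> ` S) (relabel \<sigma> S x) = lin_ext (\<lambda>w. nc_delta (map \<sigma> w)) x"
      unfolding noncrossing_quotient_eq relabel_def by (subst lin_ext_lin_ext) auto
    ultimately show "noncrossing_quotient (\<sigma> ` S) (relabel \<sigma> S x) = relabel \<sigma> S (noncrossing_quotient S x)"
      using lin_ext_cong[of x "\<lambda>w. relabel \<sigma> S (nc_delta w)"] by metis
  qed (use in_N in blast)
  moreover have "noncrossing_quotient S ` val ?W S = val ?N S" for S
  proof
    show "noncrossing_quotient S ` val ?W S \<subseteq> val ?N S"
      using in_N by blast
    show "val ?N S \<subseteq> noncrossing_quotient S ` val ?W S"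
    proof
      fix x assume x: "x \<in> val ?N S"
      show "x \<in> noncrossing_quotient S ` val ?W S"
        using retract[OF x] x sub by (intro image_eqI[of _ _ x]) auto
    qed
  qed
  moreover have "{x \<in> val ?W S. noncrossing_quotient S x = 0} = val ?X S" for S
  proof -
    have "noncrossing_quotient S x = 0 \<longleftrightarrow> (\<forall>w. x w \<noteq> 0 \<longrightarrow> crossing w)" if "x \<in> val ?W S" for x
      using noncrossing_quotient_apply[OF that] by (auto simp: fun_eq_iff)
    moreover have "x \<in> val ?X S \<longleftrightarrow> x \<in> val ?W S \<and> (\<forall>w. x w \<noteq> 0 \<longrightarrow> crossing w)" for x
      by (auto simp: val_word_subspecies span_delta)
    ultimately show ?thesis by blast
  qed
  ultimately show ?thesis
    unfolding is_quotient_map_def word_species_eq crossing_species_eq noncrossing_species_eq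
    by (simp add: is_species_word_subspecies crossing_map_iff)
qed

section \<open>The comultiplication and its composites on single words\<close>

lemma finite_maps_to: "maps_to S f T \<Longrightarrow> finite T"
  by (simp add: maps_to_def)

lemma maps_to_compose:
  "maps_to S f T \<Longrightarrow> g \<in> T \<rightarrow> U \<Longrightarrow> finite U \<Longrightarrow> maps_to S (compose S g f) U"
  by (auto simp: maps_to_def compose_def)

lemma pure_cong:
  assumes "x = x'" "\<And>t. t \<in> T \<Longrightarrow> y t = y' t"
  shows "pure T x y = pure T x' y'"
  using assms by (auto simp: pure_def intro!: prod.cong ext)

lemma pure_apply: "pure T x y p = x (fst p) * (\<Prod>t\<in>T. y t (snd p t))"
  by (simp add: pure_def case_prod_beta)

lemma component_apply: "component \<theta> f T z = \<theta> (f, T, z)"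
  by (simp add: component_def)

lemma component_lin_ext: "component (lin_ext m x) f T = lin_ext (\<lambda>w. component (m w) f T) x"
  by (simp add: component_def lin_ext_apply fun_eq_iff)

text \<open>The composite of the comultiplication with maps \<open>A\<close> and \<open>B\<close> on its two kinds of factors.\<close>

definition cut ::
  "'a set \<Rightarrow> ('a set \<Rightarrow> 'a list \<Rightarrow> 'b \<Rightarrow> 'k) \<Rightarrow> ('a set \<Rightarrow> 'a list \<Rightarrow> 'c \<Rightarrow> 'k) \<Rightarrow>
   'a list \<Rightarrow> ('a \<Rightarrow> 'a) \<times> 'a set \<times> 'b \<times> ('a \<Rightarrow> 'c) \<Rightarrow> 'k::field" where
  "cut S A B w = (\<lambda>(f, T, z).
     if maps_to S f T \<and> f ` S = T
     then pure T (A T (reduction (map f w)))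
            (\<lambda>t. B (fiber S f t) (reduction (word_restrict w (fiber S f t)))) z
     else 0)"

lemma word_comult_eq: "word_comult S = lin_ext (cut S (\<lambda>T. delta) (\<lambda>R. delta))"
  unfolding word_comult_def cut_def by (rule refl)

lemma component_cut:
  "component (cut S A B w) f T =
     (if maps_to S f T \<and> f ` S = T
      then pure T (A T (reduction (map f w)))
            (\<lambda>t. B (fiber S f t) (reduction (word_restrict w (fiber S f t))))
      else 0)"
  by (auto simp: component_def cut_def fun_eq_iff)

lemma reduction_map_words:
  assumes "w \<in> words S"
  shows "reduction (map f w) \<in> words (f ` S)"
  using assms by (intro reduction_words) (auto simp: words_def reduced_word_def)

lemma reduction_restrict_words:
  assumes "w \<in> words S" "t \<in> f ` S"
  shows "reduction (word_restrict w (fiber S f t)) \<in> words (fiber S f t)"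
  using assms by (intro reduction_words) (auto simp: words_def word_restrict_def fiber_def)

lemma component_cut_in_tensor:
  assumes w: "w \<in> words S"
    and A: "\<And>T v. v \<in> words T \<Longrightarrow> A T v \<in> V T"
    and B: "\<And>R v. v \<in> words R \<Longrightarrow> B R v \<in> W R"
  shows "component (cut S A B w) f T \<in> tensor (V T) T (\<lambda>t. W (fiber S f t))"
proof (cases "maps_to S f T \<and> f ` S = T")
  case True
  then have "A T (reduction (map f w)) \<in> V T"
    using A reduction_map_words[OF w, of f] by auto
  moreover have "B (fiber S f t) (reduction (word_restrict w (fiber S f t))) \<in> W (fiber S f t)"
    if "t \<in> T" for t
    using B reduction_restrict_words[OF w, of t f] True that by auto
  ultimately show ?thesis
    using True by (simp add: component_cut pure_in_tensor)
next
  case False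
  then show ?thesis
    by (auto simp: component_cut fun_space.subspace_0 subspace_tensor)
qed

lemma linear_on_component_lin_ext_cut:
  assumes L: "linear_on (tensor (V T) T (\<lambda>t. W (fiber S f t))) L"
    and x: "x \<in> val (word_subspecies P) S"
    and A: "\<And>T v. v \<in> words T \<Longrightarrow> A T v \<in> V T"
    and B: "\<And>R v. v \<in> words R \<Longrightarrow> B R v \<in> W R"
  shows "L (component (lin_ext (cut S A B) x) f T) = lin_ext (\<lambda>w. L (component (cut S A B w) f T)) x"
  unfolding component_lin_ext using L subspace_tensor
proof (rule linear_on_lin_ext_commute)
  fix w assume "x w \<noteq> 0"
  then show "component (cut S A B w) f T \<in> tensor (V T) T (\<lambda>t. W (fiber S f t))"
    using x A B by (intro component_cut_in_tensor) (auto dest: val_nonzeroD)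
qed

text \<open>Composites of the comultiplication stay of the form \<open>lin_ext (cut S A B)\<close>:
  a further pair of linear maps is absorbed into \<open>A\<close> and \<open>B\<close>. This is what
  reduces the cooperad axioms to statements about cuts of one word.\<close>

lemma pleth_map_lin_ext_cut:
  fixes C :: "('a, 'a list, 'k::field) species"
    and \<phi> :: "'a set \<Rightarrow> ('a list \<Rightarrow> 'k) \<Rightarrow> 'd \<Rightarrow> 'k"
    and \<psi> :: "'a set \<Rightarrow> ('a list \<Rightarrow> 'k) \<Rightarrow> 'e \<Rightarrow> 'k"
  assumes C: "C = word_subspecies P" and x: "x \<in> val (word_subspecies Q) S"
    and A: "\<And>T v. v \<in> words T \<Longrightarrow> A T v \<in> val C T"
    and B: "\<And>R v. v \<in> words R \<Longrightarrow> B R v \<in> val C R"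
    and \<phi>: "\<And>T. linear_on (val C T) (\<phi> T)" and \<psi>: "\<And>R. linear_on (val C R) (\<psi> R)"
  shows "pleth_map C C \<phi> \<psi> S (lin_ext (cut S A B) x) =
           lin_ext (cut S (\<lambda>T v. \<phi> T (A T v)) (\<lambda>R v. \<psi> R (B R v))) x"
proof
  fix p :: "('a \<Rightarrow> 'a) \<times> 'a set \<times> 'd \<times> ('a \<Rightarrow> 'e)"
  obtain f T z where p: "p = (f, T, z)" by (cases p)
  show "pleth_map C C \<phi> \<psi> S (lin_ext (cut S A B) x) p =
          lin_ext (cut S (\<lambda>T v. \<phi> T (A T v)) (\<lambda>R v. \<psi> R (B R v))) x p"
  proof (cases "maps_to S f T")
    case True
    then have fin: "finite T" by (rule finite_maps_to)
    let ?L = "tensor_map (val C T) T (\<lambda>t. val C (fiber S f t)) (\<phi> T) (\<lambda>t. \<psi> (fiber S f t))"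
    have val: "val C R = fun_space.span (delta ` {w \<in> words R. P w})" for R
      unfolding C val_word_subspecies ..
    have pure: "?L (pure T a b) = pure T (\<phi> T a) (\<lambda>t. \<psi> (fiber S f t) (b t))"
      if "a \<in> val C T" "\<And>t. t \<in> T \<Longrightarrow> b t \<in> val C (fiber S f t)" for a b
      using tensor_map_pure[OF fin val val \<phi> \<psi> that] .
    have L: "linear_on (tensor (val C T) T (\<lambda>t. val C (fiber S f t))) ?L"
      by (rule linear_on_tensor_map[OF fin val val \<phi> \<psi>])
    have "?L (component (cut S A B w) f T) =
            component (cut S (\<lambda>T v. \<phi> T (A T v)) (\<lambda>R v. \<psi> R (B R v)) w) f T" if "x w \<noteq> 0" for w
    proof (cases "f ` S = T")
      case surj: True
      have w: "w \<in> words S" using val_nonzeroD(1)[OF x that] .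
      have "A T (reduction (map f w)) \<in> val C T"
        using A reduction_map_words[OF w, of f] surj by auto
      moreover have "B (fiber S f t) (reduction (word_restrict w (fiber S f t))) \<in> val C (fiber S f t)"
        if "t \<in> T" for t
        using B reduction_restrict_words[OF w, of t f] surj that by auto
      ultimately show ?thesis
        using True surj by (simp add: component_cut pure)
    next
      case False
      then show ?thesis
        using linear_on_zero[OF L subspace_tensor] by (simp add: component_cut)
    qed
    then have "lin_ext (\<lambda>w. ?L (component (cut S A B w) f T)) x =
        lin_ext (\<lambda>w. component (cut S (\<lambda>T v. \<phi> T (A T v)) (\<lambda>R v. \<psi> R (B R v)) w) f T) x"
      by (rule lin_ext_cong)
    moreover have "?L (component (lin_ext (cut S A B) x) f T) =
        lin_ext (\<lambda>w. ?L (component (cut S A B w) f T)) x"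
      using L x A B by (rule linear_on_component_lin_ext_cut[where V = "val C" and W = "val C"])
    ultimately have "?L (component (lin_ext (cut S A B) x) f T) =
        lin_ext (\<lambda>w. component (cut S (\<lambda>T v. \<phi> T (A T v)) (\<lambda>R v. \<psi> R (B R v)) w) f T) x"
      by simp
    then show ?thesis
      using True by (simp add: pleth_map_def p component_lin_ext[symmetric] component_apply)
  next
    case False
    then show ?thesis
      by (simp add: p pleth_map_def lin_ext_apply cut_def)
  qed
qed

text \<open>The word comultiplication with every tensor factor projected to N. The formula makes
  sense on all of W, and there it vanishes on crossing words.\<close>

definition nc_comult ::
  "'a set \<Rightarrow> ('a list \<Rightarrow> 'k::field) \<Rightarrow> ('a \<Rightarrow> 'a) \<times> 'a set \<times> 'a list \<times> ('a \<Rightarrow> 'a list) \<Rightarrow> 'k" where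
  "nc_comult S = lin_ext (cut S (\<lambda>T. nc_delta) (\<lambda>R. nc_delta))"

lemma cut_crossing:
  fixes w :: "'a list"
  assumes "crossing w" "w \<in> words S"
  shows "cut S (\<lambda>T. nc_delta) (\<lambda>R. nc_delta) w = 0"
proof
  fix p :: "('a \<Rightarrow> 'a) \<times> 'a set \<times> 'a list \<times> ('a \<Rightarrow> 'a list)"
  obtain f T z where p: "p = (f, T, z)" by (cases p)
  show "cut S (\<lambda>T. nc_delta) (\<lambda>R. nc_delta) w p = (0 :: _ \<Rightarrow> 'b::field) p"
  proof (cases "maps_to S f T \<and> f ` S = T")
    case True
    have "crossing (map f w) \<or> (\<exists>t\<in>T. crossing (word_restrict w (fiber S f t)))"
      using crossing_image_or_fiber[OF assms(1), of f] assms(2) True by (auto simp: words_def)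
    then show ?thesis
      using True finite_maps_to[of S f T] by (auto simp: p cut_def pure_apply nc_delta_def)
  qed (auto simp: p cut_def)
qed

text \<open>This is the descent of the comultiplication on basis words: for a crossing word both
  sides are 0, by \<open>cut_crossing\<close>.\<close>

lemma nc_comult_nc_delta:
  "w \<in> words S \<Longrightarrow> nc_comult S (nc_delta w) = cut S (\<lambda>T. nc_delta) (\<lambda>R. nc_delta) w"
  by (cases "crossing w") (simp_all add: nc_comult_def nc_delta_def cut_crossing)

lemma word_restrict_map:
  assumes "set w \<subseteq> S"
  shows "word_restrict (map \<rho> w) (fiber (\<rho> ` S) f t) = map \<rho> (word_restrict w (fiber S (compose S f \<rho>) t))"
  unfolding word_restrict_def filter_map
  using assms by (intro arg_cong[of _ _ "map \<rho>"] filter_cong) (auto simp: fiber_def compose_def)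

lemma map_compose: "set w \<subseteq> S \<Longrightarrow> map (compose S g f) w = map g (map f w)"
  by (auto simp: compose_def)

lemma fiber_inj_compose:
  assumes "maps_to S f T" "inj_on \<sigma> T" "t \<in> T"
  shows "fiber S (compose S \<sigma> f) (\<sigma> t) = fiber S f t"
proof -
  have "f s \<in> T" if "s \<in> S" for s
    using assms(1) that by (auto simp: maps_to_def)
  then show ?thesis
    using assms(2,3) by (auto simp: fiber_def compose_def inj_on_eq_iff)
qed

text \<open>A crossing needs two distinct letters, so no word on a singleton is lost in N; on all
  other sets the counit is 0 anyway.\<close>

lemma word_counit_nc_delta:
  assumes "w \<in> words S"
  shows "word_counit S (nc_delta w) = (if card S = 1 then 1 else 0)"
proof (cases "card S = 1")
  case True
  then obtain a where "S = {a}" by (auto simp: card_1_singleton_iff)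
  have "noncrossing w"
  proof
    assume "crossing w"
    then obtain b c where "b \<noteq> c" "subseq [b, c, b, c] w"
      unfolding crossing_def by blast
    moreover from this(2) have "b \<in> S" "c \<in> S"
      using crossing_letters[of b c w] assms by (auto simp: words_def)
    ultimately show False
      using \<open>S = {a}\<close> by simp
  qed
  then show ?thesis using True by (simp add: word_counit_def nc_delta_def fun_eq_iff)
next
  case False
  then show ?thesis by (simp add: word_counit_def lin_ext_apply fun_eq_iff)
qed

text \<open>
  On words, both iterated decompositions along \<open>f\<close> and \<open>g\<close> give the reductions of \<open>g (f w)\<close>, of
  \<open>f w\<close> restricted to the fibers of \<open>g\<close>, and of \<open>w\<close> restricted to the fibers of \<open>f\<close>, since
  reduction commutes with relabeling and with restriction up to a further reduction.
\<close>

lemma cut_coassoc: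
  fixes w :: "'a list"
  assumes w: "w \<in> words S"
  shows "pleth_assoc S (cut S (\<lambda>T. nc_delta) (\<lambda>R. cut R (\<lambda>T. nc_delta) (\<lambda>R. nc_delta)) w) =
           (cut S (\<lambda>T. cut T (\<lambda>T. nc_delta) (\<lambda>R. nc_delta)) (\<lambda>R. nc_delta) w :: _ \<Rightarrow> 'k::field)"
    (is "?lhs = ?rhs")
proof
  have set: "set w = S" using w by (simp add: words_def)
  let ?cut = "\<lambda>S w. cut S (\<lambda>T. nc_delta) (\<lambda>R. nc_delta) w :: ('a \<Rightarrow> 'a) \<times> 'a set \<times> 'a list \<times> ('a \<Rightarrow> 'a list) \<Rightarrow> 'k"
  fix p :: "('a \<Rightarrow> 'a) \<times> 'a set \<times> (('a \<Rightarrow> 'a) \<times> 'a set \<times> 'a list \<times> ('a \<Rightarrow> 'a list)) \<times> ('a \<Rightarrow> 'a list)"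
  obtain f T q c where "p = (f, T, q, c)" by (cases p)
  moreover obtain g U a b where "q = (g, U, a, b)" by (cases q)
  ultimately have p: "p = (f, T, (g, U, a, b), c)" by simp
  show "?lhs p = ?rhs p"
  proof (cases "maps_to S f T \<and> maps_to T g U")
    case False
    then show ?thesis
    proof -
      have "?lhs p = 0"
        using False by (auto simp: p pleth_assoc_def)
      moreover have "?rhs p = 0"
      proof (cases "maps_to S f T")
        case True
        \<comment> \<open>Here \<open>g\<close> is not a map from \<open>T\<close> to
          \<open>U\<close>, so the inner cut, which is the first tensor factor on the right,
          vanishes at this coordinate.\<close>
        then have "?cut T (reduction (map f w)) (g, U, a, b) = 0"
          using False by (simp add: cut_def)
        then show ?thesis
          by (simp add: p cut_def[of S] pure_apply)
      qed (simp add: p cut_def)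
      ultimately show ?thesis by simp
    qed
  next
    case True
    then have f: "f \<in> S \<rightarrow>\<^sub>E T" and g: "g \<in> T \<rightarrow>\<^sub>E U" and fin: "finite T" "finite U"
      by (auto simp: maps_to_def)
    define h where "h = compose S g f"
    have h: "maps_to S h U"
      using True fin by (auto simp: h_def maps_to_def compose_def)
    have h_apply: "h s = g (f s)" if "s \<in> S" for s
      using that by (simp add: h_def compose_def)
    let ?S = "\<lambda>u. fiber S h u" and ?T = "\<lambda>u. fiber T g u"
    let ?f = "\<lambda>u. restrict f (?S u)"
    let ?w = "\<lambda>u. reduction (word_restrict w (?S u))"
    have maps: "maps_to (?S u) (?f u) (?T u)" for u
      using f fin h_apply by (auto simp: maps_to_def fiber_def)
    have lhs: "?lhs p = (if h ` S = U
        then nc_delta (reduction (map h w)) a * (\<Prod>u\<in>U. ?cut (?S u) (?w u) (?f u, ?T u, b u, c)) else 0)"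
      using True h by (simp add: p pleth_assoc_def h_def[symmetric] cut_def[of S] pure_apply)
    have rhs: "?rhs p = (if f ` S = T
        then ?cut T (reduction (map f w)) (g, U, a, b) *
          (\<Prod>t\<in>T. nc_delta (reduction (word_restrict w (fiber S f t))) (c t)) else 0)"
      using True by (simp add: p cut_def[of S] pure_apply)
    show ?thesis
    proof (cases "f ` S = T")
      case surj: True
      then have image: "h ` S = g ` T"
        using h_apply by (auto simp: image_image[symmetric] cong: image_cong_simp)
      show ?thesis
      proof (cases "g ` T = U")
        case surj_g: True
        \<comment> \<open>The inner cut over \<open>u\<close> contributes one factor for the fiber
          of \<open>g\<close> at \<open>u\<close> and one for each fiber of \<open>f\<close> at a
          letter of that fiber.\<close>
        have factor: "?cut (?S u) (?w u) (?f u, ?T u, b u, c) =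
            nc_delta (reduction (word_restrict (reduction (map f w)) (?T u))) (b u) *
            (\<Prod>t\<in>?T u. nc_delta (reduction (word_restrict w (fiber S f t))) (c t))" for u
        proof -
          have "?f u ` ?S u = ?T u"
            using surj h_apply by (auto simp: fiber_def)
          moreover have "reduction (map (?f u) (?w u)) = reduction (word_restrict (reduction (map f w)) (?T u))"
          proof -
            have "map (?f u) (word_restrict w (?S u)) = map f (word_restrict w (?S u))"
              by (auto simp: word_restrict_def)
            also have "\<dots> = word_restrict (map f w) (?T u)"
              unfolding word_restrict_def filter_map
              using set f h_apply by (intro arg_cong[of _ _ "map f"] filter_cong) (auto simp: fiber_def)
            finally show ?thesis
              by (simp add: reduction_map_reduction reduction_restrict_reduction)
          qed
          moreover have "reduction (word_restrict (?w u) (fiber (?S u) (?f u) t)) =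
              reduction (word_restrict w (fiber S f t))" if "t \<in> ?T u" for t
          proof -
            have "word_restrict (word_restrict w (?S u)) (fiber (?S u) (?f u) t) = word_restrict w (fiber S f t)"
              unfolding word_restrict_def filter_filter
              using that set h_apply by (intro filter_cong) (auto simp: fiber_def)
            then show ?thesis by (simp add: reduction_restrict_reduction)
          qed
          ultimately show ?thesis
            using maps by (simp add: cut_def pure_apply)
        qed
        \<comment> \<open>The fibers of \<open>g\<close> partition \<open>T\<close>, so the factors
          collected over all \<open>u\<close> are exactly those of the right-hand side.\<close>
        have "(\<Prod>u\<in>U. \<Prod>t\<in>?T u. nc_delta (reduction (word_restrict w (fiber S f t))) (c t)) =
            (\<Prod>t\<in>T. nc_delta (reduction (word_restrict w (fiber S f t))) (c t) :: 'k)"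
          unfolding fiber_def[of T] using fin surj_g by (intro prod.group) auto
        moreover have "reduction (map g (reduction (map f w))) = reduction (map h w)"
          using set by (simp add: reduction_map_reduction h_def map_compose)
        ultimately show ?thesis
          unfolding lhs rhs factor
          using True surj surj_g image by (simp add: prod.distrib cut_def pure_apply)
      next
        case False
        then show ?thesis
          unfolding lhs rhs using image by (simp add: cut_def)
      qed
    next
      case False
      \<comment> \<open>The right-hand side is 0 since \<open>f\<close> is not onto. On the left, a
        missed letter \<open>t\<close> makes the restriction of \<open>f\<close> over
        \<open>g t\<close> miss it too, and that single factor annihilates the product.\<close>
      then obtain t where t: "t \<in> T" "t \<notin> f ` S"
        using f by blast
      have "?f (g t) ` ?S (g t) \<noteq> ?T (g t)"
        using t by (auto simp: fiber_def)
      then have "?cut (?S (g t)) (?w (g t)) (?f (g t), ?T (g t), b (g t), c) = 0"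
        by (simp add: cut_def)
      moreover have "g t \<in> U" using g t by auto
      ultimately have "(\<Prod>u\<in>U. ?cut (?S u) (?w u) (?f u, ?T u, b u, c)) = 0"
        using fin by (intro prod_zero) auto
      then show ?thesis
        unfolding lhs rhs using False by simp
    qed
  qed
qed

text \<open>A cut evaluates \<open>A\<close> and \<open>B\<close> only at pangrammatic reduced
  words, which is where identities such as \<open>nc_comult_nc_delta\<close> are available.\<close>

lemma cut_cong:
  assumes w: "w \<in> words S"
    and A: "\<And>T v. v \<in> words T \<Longrightarrow> A T v = A' T v"
    and B: "\<And>R v. v \<in> words R \<Longrightarrow> B R v = B' R v"
  shows "cut S A B w = cut S A' B' w"
proof -
  have "pure (f ` S) (A (f ` S) (reduction (map f w)))
          (\<lambda>t. B (fiber S f t) (reduction (word_restrict w (fiber S f t)))) =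
        pure (f ` S) (A' (f ` S) (reduction (map f w)))
          (\<lambda>t. B' (fiber S f t) (reduction (word_restrict w (fiber S f t))))" for f
    using A[OF reduction_map_words[OF w]] B[OF reduction_restrict_words[OF w]]
    by (intro pure_cong)
  then show ?thesis
    unfolding cut_def by (intro ext) (auto split: prod.split)
qed

section \<open>The cooperad axioms for the non-crossing species\<close>

context
  fixes N :: "('a, 'a list, 'k::field) species"
  assumes N_def: "N = word_subspecies noncrossing"
begin

lemma val_N: "val N S = fun_space.span (delta ` {w \<in> words S. noncrossing w})"
  by (simp add: N_def val_word_subspecies)

lemma act_N [simp]: "act N = relabel"
  by (simp add: N_def)

lemma nc_delta_in_val_N: "w \<in> words S \<Longrightarrow> nc_delta w \<in> val N S"
  by (simp add: N_def nc_delta_in_val)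

lemma val_N_words: "x \<in> val N S \<Longrightarrow> x w \<noteq> 0 \<Longrightarrow> w \<in> words S"
  by (auto simp: N_def dest: val_nonzeroD)

text \<open>The limit condition holds because an injective \<open>\<sigma>\<close> commutes with
  reduction and with the projection to N, while \<open>f\<close> and its composite with
  \<open>\<sigma>\<close> have the same fibers.\<close>

lemma nc_comult_in_pleth:
  assumes x: "x \<in> val N S"
  shows "nc_comult S x \<in> val (pleth N N) S"
proof -
  let ?cut = "cut S (\<lambda>T. nc_delta) (\<lambda>R. nc_delta)"
  have "component (nc_comult S x) f T \<in> tensor (val N T) T (\<lambda>t. val N (fiber S f t))" for f T
    unfolding nc_comult_def component_lin_ext
    by (intro lin_ext_in_subspace subspace_tensor component_cut_in_tensor nc_delta_in_val_N
        val_N_words[OF x])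
  moreover have "component (nc_comult S x) f T = 0" if "\<not> maps_to S f T" for f T
    using that by (simp add: nc_comult_def component_lin_ext component_cut) (simp add: lin_ext_def)
  moreover have "component (nc_comult S x) (compose S \<sigma> f) (\<sigma> ` T) =
      tensor_lift (val N T) T (\<lambda>t. val N (fiber S f t))
        (\<lambda>x y. pure (\<sigma> ` T) (relabel \<sigma> T x) (\<lambda>t'. y (inv_into T \<sigma> t')))
        (component (nc_comult S x) f T)"
    if f: "maps_to S f T" and \<sigma>: "inj_on \<sigma> T" for f T \<sigma>
  proof -
    have fin: "finite T" using finite_maps_to[OF f] .
    let ?m = "\<lambda>x y. pure (\<sigma> ` T) (relabel \<sigma> T x) (\<lambda>t'. y (inv_into T \<sigma> t'))
                :: 'a list \<times> ('a \<Rightarrow> 'a list) \<Rightarrow> 'k"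
    let ?L = "tensor_lift (val N T) T (\<lambda>t. val N (fiber S f t)) ?m"
    \<comment> \<open>Reindexing the product along \<open>\<sigma>\<close> brings the map to the
      shape required by \<open>tensor_lift_product\<close>, with the coordinate at
      \<open>\<sigma> t\<close> selected for the factor at \<open>t\<close>.\<close>
    have m: "?m x y d = relabel \<sigma> T x (fst d) * (\<Prod>t\<in>T. y t (snd d (\<sigma> t)))" for x y d
      using \<sigma> by (simp add: pure_apply prod.reindex)
    have lin: "linear_on (val N T) (relabel \<sigma> T)"
      unfolding N_def relabel_def by (rule linear_on_val_lin_ext)
    note L = tensor_lift_product[where m = ?m, OF fin val_N val_N lin linear_on_id m]
    have "?L (component (?cut w) f T) = component (?cut w) (compose S \<sigma> f) (\<sigma> ` T)" if "x w \<noteq> 0" for w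
    proof (cases "f ` S = T")
      case True
      have w: "w \<in> words S" using val_N_words[OF x that] .
      have maps: "maps_to S (compose S \<sigma> f) (\<sigma> ` T)"
        using f fin by (intro maps_to_compose) auto
      have surj: "compose S \<sigma> f ` S = \<sigma> ` T"
        using True by (auto simp: compose_def)
      have image: "reduction (map f w) \<in> words T"
        using reduction_map_words[OF w, of f] True by simp
      have "?L (component (?cut w) f T) = ?m (nc_delta (reduction (map f w)))
          (\<lambda>t. nc_delta (reduction (word_restrict w (fiber S f t))))"
        using True f image reduction_restrict_words[OF w, of _ f]
        by (simp add: component_cut L(2) nc_delta_in_val_N)
      also have "\<dots> = component (?cut w) (compose S \<sigma> f) (\<sigma> ` T)"
      proof -
        have set: "set (map f w) = T" using w True by (auto simp: words_def)
        have "reduction (map \<sigma> (map f w)) = map \<sigma> (reduction (map f w))"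
          using \<sigma> set by (intro reduction_map_inj) simp
        then have "relabel \<sigma> T (nc_delta (reduction (map f w))) =
            (nc_delta (reduction (map \<sigma> (map f w))) :: 'a list \<Rightarrow> 'k)"
          using \<sigma> set by (simp add: relabel_nc_delta del: map_map)
        then show ?thesis
          using maps surj w \<sigma> fiber_inj_compose[OF f \<sigma>]
          by (auto simp: component_cut map_compose words_def intro!: pure_cong)
      qed
      finally show ?thesis .
    next
      case False
      \<comment> \<open>Since \<open>\<sigma>\<close> is injective, surjectivity of \<open>f\<close>
        and of its composite onto the image of \<open>T\<close> fail together, and both components
        are 0.\<close>
      then have "compose S \<sigma> f ` S \<noteq> \<sigma> ` T"
      proof -
        have "f ` S \<subseteq> T" using f by (auto simp: maps_to_def)
        moreover have "compose S \<sigma> f ` S = \<sigma> ` f ` S"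
          by (auto simp: compose_def)
        ultimately show ?thesis
          using False inj_on_image_eq_iff[OF \<sigma>, of "f ` S" T] by simp
      qed
      then show ?thesis
        using False linear_on_zero[OF L(1) subspace_tensor] by (simp add: component_cut)
    qed
    then show ?thesis
      unfolding nc_comult_def
      using linear_on_component_lin_ext_cut[of "val N" T "val N" S f ?L x noncrossing]
        L(1) x nc_delta_in_val_N
      by (simp add: N_def component_lin_ext cong: lin_ext_cong)
  qed
  ultimately show ?thesis
    by (simp add: pleth_def)
qed

text \<open>A map \<open>f\<close> on the relabeled set pulls back to its composite with
  \<open>\<rho>\<close>. The image word is the same for both, and the restrictions to fibers
  correspond under \<open>\<rho>\<close>.\<close>

lemma nc_comult_relabel:
  assumes \<rho>: "inj_on \<rho> S" and x: "x \<in> val N S"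
  shows "nc_comult (\<rho> ` S) (relabel \<rho> S x) = act (pleth N N) \<rho> S (nc_comult S x)"
proof
  let ?cut = "\<lambda>S. cut S (\<lambda>T. nc_delta) (\<lambda>R. nc_delta)"
  fix p :: "('a \<Rightarrow> 'a) \<times> 'a set \<times> 'a list \<times> ('a \<Rightarrow> 'a list)"
  obtain f T z where p: "p = (f, T, z)" by (cases p)
  have lhs: "nc_comult (\<rho> ` S) (relabel \<rho> S x) = lin_ext (\<lambda>w. ?cut (\<rho> ` S) (map \<rho> w)) x"
    unfolding nc_comult_def relabel_def by (subst lin_ext_lin_ext) auto
  show "nc_comult (\<rho> ` S) (relabel \<rho> S x) p = act (pleth N N) \<rho> S (nc_comult S x) p"
  proof (cases "maps_to (\<rho> ` S) f T")
    case True
    then have fin: "finite T" by (rule finite_maps_to)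
    define g where "g = compose S f \<rho>"
    have g: "maps_to S g T"
      using True by (auto simp: g_def maps_to_def compose_def)
    have image: "g ` S = f ` \<rho> ` S"
      by (auto simp: g_def compose_def)
    let ?L = "tensor_map (val N T) T (\<lambda>t. val N (fiber S g t)) (\<lambda>x. x) (\<lambda>t. relabel \<rho> (fiber S g t))"
    have lin: "linear_on (val N R) (relabel \<rho> R)" for R
      unfolding N_def relabel_def by (rule linear_on_val_lin_ext)
    note L = tensor_map[OF fin val_N val_N linear_on_id lin]
    have "?L (component (?cut S w) g T) = component (?cut (\<rho> ` S) (map \<rho> w)) f T" if "x w \<noteq> 0" for w
    proof (cases "g ` S = T")
      case surj: True
      have w: "w \<in> words S" using val_N_words[OF x that] .
      then have set: "set w = S" by (simp add: words_def)
      have image_word: "reduction (map g w) \<in> words T"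
        using reduction_map_words[OF w, of g] surj by simp
      have "?L (component (?cut S w) g T) = pure T (nc_delta (reduction (map g w)))
          (\<lambda>t. relabel \<rho> (fiber S g t) (nc_delta (reduction (word_restrict w (fiber S g t)))))"
        using g surj image_word reduction_restrict_words[OF w, of _ g]
        by (simp add: component_cut L(2) nc_delta_in_val_N)
      also have "\<dots> = component (?cut (\<rho> ` S) (map \<rho> w)) f T"
      proof -
        have "relabel \<rho> (fiber S g t) (nc_delta (reduction (word_restrict w (fiber S g t)))) =
            (nc_delta (reduction (word_restrict (map \<rho> w) (fiber (\<rho> ` S) f t))) :: 'a list \<Rightarrow> 'k)" for t
        proof -
          have "inj_on \<rho> (set (word_restrict w (fiber S g t)))"
            using \<rho> by (rule inj_on_subset) (auto simp: word_restrict_def fiber_def)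
          then show ?thesis
            using set by (simp add: word_restrict_map g_def[symmetric] relabel_nc_delta reduction_map_inj)
        qed
        then show ?thesis
          using True surj image set by (simp add: component_cut g_def map_compose)
      qed
      finally show ?thesis .
    next
      case False
      then show ?thesis
        using linear_on_zero[OF L(1) subspace_tensor] image by (simp add: component_cut)
    qed
    then have "?L (component (nc_comult S x) g T) = component (nc_comult (\<rho> ` S) (relabel \<rho> S x)) f T"
      unfolding lhs unfolding nc_comult_def
      using linear_on_component_lin_ext_cut[of "val N" T "val N" S g ?L x noncrossing]
        L(1) x nc_delta_in_val_N
      by (simp add: N_def component_lin_ext cong: lin_ext_cong)
    then show ?thesis
      using True by (simp add: p pleth_def g_def Let_def component_apply)
  next
    case False
    then show ?thesis
      by (simp add: p pleth_def lhs lin_ext_apply cut_def)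
  qed
qed

lemma linear_on_nc_comult: "linear_on (val N S) (nc_comult S)"
  unfolding nc_comult_def N_def by (rule linear_on_val_lin_ext)

lemma linear_on_word_counit: "linear_on (val N S) (word_counit S)"
  unfolding word_counit_def N_def by (rule linear_on_val_lin_ext)

lemma linear_on_id_hom: "linear_on (val N S) (id_hom S)"
  by (simp add: linear_on_def id_hom_def)

lemma pleth_map_nc_comult:
  assumes "x \<in> val N S" "\<And>T. linear_on (val N T) (\<phi> T)" "\<And>R. linear_on (val N R) (\<psi> R)"
  shows "pleth_map N N \<phi> \<psi> S (nc_comult S x) =
           lin_ext (cut S (\<lambda>T v. \<phi> T (nc_delta v)) (\<lambda>R v. \<psi> R (nc_delta v))) x"
  unfolding nc_comult_def
  by (rule pleth_map_lin_ext_cut[OF N_def assms(1)[unfolded N_def] nc_delta_in_val_N nc_delta_in_val_N assms(2,3)])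

text \<open>Reduces the counit laws, whose right-hand sides are linear in \<open>x\<close>, to
  non-crossing basis words.\<close>

lemma lin_ext_eq_linear:
  assumes "linear_on (val N S) L" "x \<in> val N S"
    and "\<And>w. w \<in> words S \<Longrightarrow> noncrossing w \<Longrightarrow> m w = L (delta w)"
  shows "lin_ext m x = L x"
proof -
  have "L x = lin_ext (\<lambda>w. L (delta w)) x"
    using assms(1,2) unfolding val_N by (rule linear_on_eq_lin_ext)
  also have "\<dots> = lin_ext m x"
    using assms(2,3) unfolding val_N by (intro lin_ext_cong) (auto dest: span_delta_nonzeroD)
  finally show ?thesis ..
qed

text \<open>The counit leaves only one-letter targets. There the single fiber is all of
  \<open>S\<close>, and restricting and reducing \<open>w\<close> returns \<open>w\<close>.\<close>

lemma nc_counit_left: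
  assumes x: "x \<in> val N S"
  shows "pleth_map N N word_counit id_hom S (nc_comult S x) = left_unit S x"
  unfolding pleth_map_nc_comult[OF x linear_on_word_counit linear_on_id_hom]
proof (rule lin_ext_eq_linear[OF _ x])
  \<comment> \<open>A pure tensor with the same vector in every factor is not linear in that vector
    in general; it is here because \<open>T\<close> has one element.\<close>
  have "left_unit S y p = (case p of (f, T, z) \<Rightarrow>
      if maps_to S f T \<and> card T = 1 then y (snd z (the_elem T)) else 0)" for y :: "'a list \<Rightarrow> 'k" and p
    by (cases p) (auto simp: left_unit_def pure_apply card_1_singleton_iff)
  then show "linear_on (val N S) (left_unit S)"
    by (auto simp: linear_on_def fun_eq_iff plus_fun_apply fscale_apply)
next
  fix w assume w: "w \<in> words S" "noncrossing w"
  then have set: "set w = S" and ne: "S \<noteq> {}"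
    by (auto simp: words_def reduced_word_def)
  show "cut S (\<lambda>T v. word_counit T (nc_delta v)) (\<lambda>R v. id_hom R (nc_delta v)) w =
          (left_unit S (delta w) :: _ \<Rightarrow> 'k)"
  proof
    fix p :: "('a \<Rightarrow> 'a) \<times> 'a set \<times> unit \<times> ('a \<Rightarrow> 'a list)"
    obtain f T z where p: "p = (f, T, z)" by (cases p)
    show "cut S (\<lambda>T v. word_counit T (nc_delta v)) (\<lambda>R v. id_hom R (nc_delta v)) w p =
            (left_unit S (delta w) :: _ \<Rightarrow> 'k) p"
    proof (cases "maps_to S f T \<and> card T = 1")
      case True
      then obtain t where T: "T = {t}" by (auto simp: card_1_singleton_iff)
      then have "f ` S = T" "fiber S f t = S"
        using True ne by (auto simp: maps_to_def fiber_def)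
      moreover have "word_restrict w S = w"
        using set by (simp add: word_restrict_def)
      moreover have "reduction w = w"
        using w by (simp add: words_def reduction_reduced)
      ultimately show ?thesis
        using True w T reduction_map_words[OF w(1), of f]
        by (simp add: p cut_def left_unit_def pure_apply id_hom_def word_counit_nc_delta)
          (simp add: nc_delta_def)
    next
      case False
      then show ?thesis
        using reduction_map_words[OF w(1), of f]
        by (auto simp: p cut_def left_unit_def pure_apply word_counit_nc_delta)
    qed
  qed
qed

text \<open>The counits on the fibers survive together exactly when \<open>f\<close> is a bijection,
  and then the relabeled word is already reduced and still non-crossing.\<close>

lemma nc_counit_right:
  assumes x: "x \<in> val N S"
  shows "pleth_map N N id_hom word_counit S (nc_comult S x) = right_unit N S x"
  unfolding pleth_map_nc_comult[OF x linear_on_id_hom linear_on_word_counit]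
proof (rule lin_ext_eq_linear[OF _ x])
  have "linear_on (val N S) (relabel f S)" for f
    unfolding N_def relabel_def by (rule linear_on_val_lin_ext)
  then show "linear_on (val N S) (right_unit N S)"
    by (auto simp: linear_on_def right_unit_def pure_apply fun_eq_iff plus_fun_apply fscale_apply)
next
  fix w assume w: "w \<in> words S" "noncrossing w"
  then have set: "set w = S"
    by (simp add: words_def)
  show "cut S (\<lambda>T v. id_hom T (nc_delta v)) (\<lambda>R v. word_counit R (nc_delta v)) w =
          (right_unit N S (delta w) :: _ \<Rightarrow> 'k)"
  proof
    fix p :: "('a \<Rightarrow> 'a) \<times> 'a set \<times> 'a list \<times> ('a \<Rightarrow> unit)"
    obtain f T z where p: "p = (f, T, z)" by (cases p)
    show "cut S (\<lambda>T v. id_hom T (nc_delta v)) (\<lambda>R v. word_counit R (nc_delta v)) w p =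
            (right_unit N S (delta w) :: _ \<Rightarrow> 'k) p"
    proof (cases "maps_to S f T \<and> f ` S = T")
      case True
      have fin: "finite T" using True finite_maps_to by blast
      \<comment> \<open>Each counit factor indicates a one-element fiber, so for surjective
        \<open>f\<close> their product indicates injectivity.\<close>
      have factor: "word_counit (fiber S f t) (nc_delta (reduction (word_restrict w (fiber S f t)))) c =
          (if card (fiber S f t) = 1 then 1 else 0 :: 'k)" if "t \<in> T" for t c
        using that True reduction_restrict_words[OF w(1), of t f] by (simp add: word_counit_nc_delta)
      have inj: "inj_on f S \<longleftrightarrow> (\<forall>t\<in>T. card (fiber S f t) = 1)"
      proof
        assume "inj_on f S"
        show "\<forall>t\<in>T. card (fiber S f t) = 1"
        proof
          fix t assume "t \<in> T"
          then obtain s where "s \<in> S" "f s = t" using True by blast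
          then have "fiber S f t = {s}"
            using \<open>inj_on f S\<close> by (auto simp: fiber_def dest: inj_onD)
          then show "card (fiber S f t) = 1" by simp
        qed
      next
        assume card: "\<forall>t\<in>T. card (fiber S f t) = 1"
        show "inj_on f S"
        proof (rule inj_onI)
          fix r s assume rs: "r \<in> S" "s \<in> S" "f r = f s"
          then have "card (fiber S f (f s)) = 1" using card True by blast
          moreover have "r \<in> fiber S f (f s)" "s \<in> fiber S f (f s)"
            using rs by (auto simp: fiber_def)
          ultimately show "r = s" by (auto simp: card_1_singleton_iff)
        qed
      qed
      have "cut S (\<lambda>T v. id_hom T (nc_delta v)) (\<lambda>R v. word_counit R (nc_delta v)) w p =
          nc_delta (reduction (map f w)) (fst z) * (\<Prod>t\<in>T. if card (fiber S f t) = 1 then 1 else 0 :: 'k)"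
        using True by (simp add: p cut_def pure_apply id_hom_def factor)
      also have "\<dots> = (right_unit N S (delta w) :: _ \<Rightarrow> 'k) p"
      proof (cases "inj_on f S")
        case inj_f: True
        have "reduction (map f w) = map f w" "noncrossing (map f w)"
          using inj_f w set by (simp_all add: reduction_map_inj crossing_map_iff words_def reduction_reduced)
        then show ?thesis
          using True inj_f inj by (simp add: p right_unit_def bij_betw_def pure_apply nc_delta_def)
      next
        case False
        then have "\<exists>t\<in>T. card (fiber S f t) \<noteq> 1" using inj by blast
        then have "(\<Prod>t\<in>T. if card (fiber S f t) = 1 then 1 else 0 :: 'k) = 0"
          using fin by (auto intro!: prod_zero)
        then show ?thesis
          using False by (simp add: p right_unit_def bij_betw_def)
      qed
      finally show ?thesis .
    next
      case False
      then show ?thesis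
        by (auto simp: p cut_def right_unit_def bij_betw_def)
    qed
  qed
qed

text \<open>\<open>pleth_assoc\<close> only substitutes coordinates or inserts zeros, so it passes
  inside the linear extension; what remains is \<open>cut_coassoc\<close> for each word in the
  support of \<open>x\<close>.\<close>

lemma nc_coassoc:
  assumes x: "x \<in> val N S"
  shows "pleth_assoc S (pleth_map N N id_hom nc_comult S (nc_comult S x)) =
           pleth_map N N nc_comult id_hom S (nc_comult S x)"
proof -
  have assoc: "pleth_assoc S (lin_ext m x) = lin_ext (\<lambda>w. pleth_assoc S (m w)) x" for m
    by (auto simp: pleth_assoc_def lin_ext_apply fun_eq_iff)
  have "pleth_assoc S (cut S (\<lambda>T v. id_hom T (nc_delta v)) (\<lambda>R v. nc_comult R (nc_delta v)) w) =
      (cut S (\<lambda>T v. nc_comult T (nc_delta v)) (\<lambda>R v. id_hom R (nc_delta v)) w :: _ \<Rightarrow> 'k)"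
    if "x w \<noteq> 0" for w
  proof -
    note w = val_N_words[OF x that]
    have "cut S (\<lambda>T v. id_hom T (nc_delta v)) (\<lambda>R v. nc_comult R (nc_delta v)) w =
        (cut S (\<lambda>T. nc_delta) (\<lambda>R. cut R (\<lambda>T. nc_delta) (\<lambda>R. nc_delta)) w :: _ \<Rightarrow> 'k)"
      by (intro cut_cong[OF w]) (simp_all add: id_hom_def nc_comult_nc_delta)
    moreover have "cut S (\<lambda>T v. nc_comult T (nc_delta v)) (\<lambda>R v. id_hom R (nc_delta v)) w =
        (cut S (\<lambda>T. cut T (\<lambda>T. nc_delta) (\<lambda>R. nc_delta)) (\<lambda>R. nc_delta) w :: _ \<Rightarrow> 'k)"
      by (intro cut_cong[OF w]) (simp_all add: id_hom_def nc_comult_nc_delta)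
    ultimately show ?thesis
      using cut_coassoc[OF w] by simp
  qed
  then show ?thesis
    unfolding pleth_map_nc_comult[OF x linear_on_id_hom linear_on_nc_comult]
      pleth_map_nc_comult[OF x linear_on_nc_comult linear_on_id_hom] assoc
    by (rule lin_ext_cong)
qed

lemma nc_counit_hom: "species_hom N unit_species word_counit"
  unfolding species_hom_def act_N
proof (intro conjI allI impI ballI; (elim conjE)?)
  fix S show "linear_on (val N S) (word_counit S)"
    by (rule linear_on_word_counit)
  show "word_counit S \<in> val N S \<rightarrow> val unit_species S"
    by (auto simp: unit_species_def word_counit_def lin_ext_apply fun_eq_iff)
next
  fix S and \<sigma> :: "'a \<Rightarrow> 'a" and x :: "'a list \<Rightarrow> 'k"
  assume "inj_on \<sigma> S"
  then have "card (\<sigma> ` S) = card S" by (rule card_image)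
  moreover have "word_counit (\<sigma> ` S) (relabel \<sigma> S x) = lin_ext (\<lambda>w. if card (\<sigma> ` S) = 1 then 1 else 0) x"
    unfolding word_counit_def relabel_def by (subst lin_ext_lin_ext) auto
  ultimately show "word_counit (\<sigma> ` S) (relabel \<sigma> S x) = act unit_species \<sigma> S (word_counit S x)"
    by (simp add: unit_species_def word_counit_def)
qed

lemma nc_cooperad: "cooperad N word_counit nc_comult"
proof -
  have "is_species N"
    unfolding N_def by (rule is_species_word_subspecies) (simp add: crossing_map_iff)
  then have "reduced_species N"
    by (simp add: reduced_species_def N_def val_empty)
  moreover have "species_hom N (pleth N N) nc_comult"
    unfolding species_hom_def
    by (simp add: linear_on_nc_comult nc_comult_in_pleth nc_comult_relabel)
  ultimately show ?thesis
    unfolding cooperad_def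
    using nc_counit_hom nc_coassoc nc_counit_left nc_counit_right by blast
qed

end

section \<open>Descent of the structure maps along the quotient map\<close>

theorem proposition1p11:
  shows "is_quotient_map
           (word_species :: ('a::infinite, 'a list, 'k::field_char_0) species)
           crossing_species noncrossing_species noncrossing_quotient \<and>
         quotient_cooperad
           (word_species :: ('a, 'a list, 'k) species) word_counit word_comult
           noncrossing_species noncrossing_quotient"
proof
  let ?W = "word_subspecies (\<lambda>w. True) :: ('a, 'a list, 'k) species"
  have "word_counit S (noncrossing_quotient S x) = word_counit S x" if x: "x \<in> val ?W S" for S and x :: "'a list \<Rightarrow> 'k"
  proof -
    have "word_counit S (noncrossing_quotient S x) = lin_ext (\<lambda>w. word_counit S (nc_delta w)) x"
      unfolding noncrossing_quotient_eq word_counit_def by (rule lin_ext_lin_ext) (rule nc_delta_in_span)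
    also have "\<dots> = lin_ext (\<lambda>w. if card S = 1 then 1 else 0) x"
      using val_nonzeroD(1)[OF x] by (intro lin_ext_cong word_counit_nc_delta)
    finally show ?thesis
      by (simp add: word_counit_def)
  qed
  \<comment> \<open>Both ways around are the linear extension of the same projected cut: on the left
    because crossing words contribute 0, on the right because the quotient maps are absorbed into
    the cut.\<close>
  moreover have "nc_comult S (noncrossing_quotient S x) =
      pleth_map ?W ?W noncrossing_quotient noncrossing_quotient S (word_comult S x)"
    if x: "x \<in> val ?W S" for S and x :: "'a list \<Rightarrow> 'k"
  proof -
    have "nc_comult S (noncrossing_quotient S x) = lin_ext (\<lambda>w. nc_comult S (nc_delta w)) x"
      unfolding noncrossing_quotient_eq nc_comult_def by (rule lin_ext_lin_ext) (rule nc_delta_in_span)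
    also have "\<dots> = lin_ext (cut S (\<lambda>T. nc_delta) (\<lambda>R. nc_delta)) x"
      using val_nonzeroD(1)[OF x] by (intro lin_ext_cong nc_comult_nc_delta)
    also have "\<dots> = lin_ext (cut S (\<lambda>T v. noncrossing_quotient T (delta v))
        (\<lambda>R v. noncrossing_quotient R (delta v))) x"
      by (simp add: noncrossing_quotient_eq)
    also have "\<dots> = pleth_map ?W ?W noncrossing_quotient noncrossing_quotient S (word_comult S x)"
      unfolding word_comult_eq
      by (rule pleth_map_lin_ext_cut[OF refl x, symmetric])
        (auto simp: delta_in_val noncrossing_quotient_eq linear_on_val_lin_ext)
    finally show ?thesis .
  qed
  ultimately show "quotient_cooperad
           (word_species :: ('a, 'a list, 'k) species) word_counit word_comult
           noncrossing_species noncrossing_quotient"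
    unfolding quotient_cooperad_def word_species_eq
    using nc_cooperad[OF noncrossing_species_eq] by blast
qed (rule is_quotient_map_noncrossing)

end
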